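(* Let $1\le p<\infty$, let $K$ be a dispersed compact Hausdorff space, let $X,Y$ be Banach spaces, and let $m\leftrightarrow T:C(K,X)\to Y$ be a strongly bounded operator such that for each $A\in\Sigma$ the operator $m(A):X\to Y$ is limited completely continuous (respectively limited $p$-convergent). Then $T$ is limited completely continuous (respectively limited $p$-convergent).
   Context: Operator means bounded linear map. $C(K,X)$ is the space of continuous functions $K\to X$ with the sup norm; $\Sigma$ is the Borel $\sigma$-algebra of $K$. Its dual is $rcabv(\Sigma,X^* )$, the regular countably additive $X^*$-valued Borel measures of bounded variation. Every operator $T:C(K,X)\to Y$ has a representing measure $m:\Sigma\to L(X,Y^{**})$ (written $m\leftrightarrow T$), $m(A)x=T^{**}(\chi_A x)$, where $\chi_A x\in C(K,X)^{**}$ acts on $\mu\in rcabv(\Sigma,X^* )$ by $\langle \mu(A),x\rangle$; one has $T(f)=\int_K f\,dm$. For $y^*\in Y^*$ put $y^*m=T^*(y^* )\in rcabv(\Sigma,X^* )$, so $\langle y^*m(A),x\rangle=\langle m(A)x,y^*\rangle$. The semivariation is $\tilde m(E)=\sup\{|y^*m|(E): \|y^*\|\le 1\}$, with $|\cdot|$ denoting variation. $T$ (or $m$) is strongly bounded if $\tilde m(A_i)\to 0$ for every decreasing sequence $(A_i)$ in $\Sigma$ with empty intersection; in that case $m$ takes values in $L(X,Y)$. A topological space is dispersed (scattered) if every nonempty closed subset has an isolated point. A bounded subset $A$ of a Banach space $E$ is limited if $\sup_{x\in A}|x_n^*(x)|\to 0$ for every $w^*$-null sequence $(x_n^* )$ in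 $E^*$. A sequence $(x_n)$ in $E$ is weakly $p$-summable if $(x^*(x_n))\in\ell_p$ for all $x^*\in E^*$. A limited weakly null (resp. limited weakly $p$-summable) sequence is a weakly null (resp. weakly $p$-summable) sequence whose set of terms is limited. An operator is limited completely continuous (resp. limited $p$-convergent) if it maps limited weakly null (resp. limited weakly $p$-summable) sequences to norm null sequences. *)

theory Defs
  imports "HOL-Analysis.Analysis"
begin

section \<open>Duals, biduals and adjoints\<close>

type_synonym 'a dual = "'a \<Rightarrow>\<^sub>L real"

definition canonical_embedding :: "'a::real_normed_vector \<Rightarrow> 'a dual dual" where
  "canonical_embedding x = Blinfun (\<lambda>\<phi>. blinfun_apply \<phi> x)"

lemma canonical_embedding_apply [simp]:
  "blinfun_apply (canonical_embedding x) \<phi> = blinfun_apply \<phi> x"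
  unfolding canonical_embedding_def
  by (subst bounded_linear_Blinfun_apply) (auto intro: blinfun.bounded_linear_left)

definition adjoint_blinfun ::
    "('a::real_normed_vector \<Rightarrow>\<^sub>L 'b::real_normed_vector) \<Rightarrow> 'b dual \<Rightarrow>\<^sub>L 'a dual" where
  "adjoint_blinfun T = Blinfun (\<lambda>\<phi>. \<phi> o\<^sub>L T)"

lemma adjoint_blinfun_apply [simp]:
  "blinfun_apply (adjoint_blinfun T) \<phi> = \<phi> o\<^sub>L T"
  unfolding adjoint_blinfun_def
  by (subst bounded_linear_Blinfun_apply)
     (auto intro: bounded_bilinear.bounded_linear_left[OF bounded_bilinear_blinfun_compose])

text \<open>The operator into \<open>Y\<close> that an operator into \<open>Y**\<close> is, when its values lie in the
  canonical copy of \<open>Y\<close>; unspecified otherwise.\<close>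

definition into_predual ::
    "('x::real_normed_vector \<Rightarrow>\<^sub>L 'y::real_normed_vector dual dual) \<Rightarrow> 'x \<Rightarrow>\<^sub>L 'y" where
  "into_predual S = (THE R. \<forall>x. blinfun_apply S x = canonical_embedding (blinfun_apply R x))"

section \<open>Vector measures on the Borel sets\<close>

text \<open>A measure is a total function on sets; only its values on Borel sets are meaningful.\<close>

definition variation ::
    "('k::topological_space set \<Rightarrow> 'e::real_normed_vector) \<Rightarrow> 'k set \<Rightarrow> ennreal" where
  "variation \<mu> E =
     (SUP P \<in> {P. finite P \<and> disjoint P \<and> P \<subseteq> sets borel \<and> \<Union>P = E}. \<Sum>B\<in>P. ennreal (norm (\<mu> B)))"

definition rcabv :: "('k::topological_space set \<Rightarrow> 'e::real_normed_vector) set" where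
  "rcabv = {\<mu>.
     (\<forall>A::nat \<Rightarrow> 'k set. range A \<subseteq> sets borel \<longrightarrow> disjoint_family A \<longrightarrow>
        (\<lambda>n. \<mu> (A n)) sums \<mu> (\<Union>n. A n)) \<and>
     variation \<mu> UNIV < \<infinity> \<and>
     (\<forall>E\<in>sets borel. \<forall>\<epsilon>>0. \<exists>C U. compact C \<and> open U \<and> C \<subseteq> E \<and> E \<subseteq> U \<and>
        variation \<mu> (U - C) < \<epsilon>)}"

definition simple_integral_dual ::
    "('k::topological_space set \<Rightarrow> 'x::real_normed_vector dual) \<Rightarrow> ('k \<Rightarrow> 'x) \<Rightarrow> real" where
  "simple_integral_dual \<mu> s = (\<Sum>v\<in>range s. blinfun_apply (\<mu> (s -` {v})) v)"

definition has_integral_dual ::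
    "('k::topological_space set \<Rightarrow> 'x::real_normed_vector dual) \<Rightarrow> ('k \<Rightarrow> 'x) \<Rightarrow> real \<Rightarrow> bool" where
  "has_integral_dual \<mu> f I \<longleftrightarrow>
     (\<exists>s. (\<forall>n. simple_function borel (s n)) \<and> uniform_limit UNIV s f sequentially \<and>
        (\<lambda>n. simple_integral_dual \<mu> (s n)) \<longlonglongrightarrow> I)"

text \<open>The identification of the dual of \<open>C(K,X)\<close> with \<open>rcabv\<close>: \<open>\<mu>\<close> corresponds to \<open>\<phi>\<close>
  if \<open>\<phi>\<close> is integration against \<open>\<mu>\<close>.\<close>

definition corresponds_to ::
    "('k::topological_space set \<Rightarrow> 'x::real_normed_vector dual) \<Rightarrow> ('k \<Rightarrow>\<^sub>C 'x) dual \<Rightarrow> bool" where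
  "corresponds_to \<mu> \<phi> \<longleftrightarrow>
     \<mu> \<in> rcabv \<and> (\<forall>f. has_integral_dual \<mu> (apply_bcontfun f) (blinfun_apply \<phi> f))"

text \<open>\<open>\<xi>\<close> is the element \<open>\<chi>\<^sub>A x\<close> of the bidual of \<open>C(K,X)\<close>. For compact Hausdorff \<open>K\<close>
  it exists and is unique, since every \<open>\<phi>\<close> corresponds to exactly one measure on the Borel
  sets.\<close>

definition is_indicator_functional ::
    "'k::topological_space set \<Rightarrow> 'x::real_normed_vector \<Rightarrow> ('k \<Rightarrow>\<^sub>C 'x) dual dual \<Rightarrow> bool" where
  "is_indicator_functional A x \<xi> \<longleftrightarrow>
     (\<forall>\<phi> \<mu>. corresponds_to \<mu> \<phi> \<longrightarrow> blinfun_apply \<xi> \<phi> = blinfun_apply (\<mu> A) x)"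

definition representing_measure ::
    "('k::topological_space set \<Rightarrow> 'x::real_normed_vector \<Rightarrow>\<^sub>L 'y::real_normed_vector dual dual) \<Rightarrow>
     (('k \<Rightarrow>\<^sub>C 'x) \<Rightarrow>\<^sub>L 'y) \<Rightarrow> bool" where
  "representing_measure m T \<longleftrightarrow>
     (\<forall>A\<in>sets borel. \<forall>x. \<exists>\<xi>. is_indicator_functional A x \<xi> \<and>
        blinfun_apply (m A) x = blinfun_apply (adjoint_blinfun (adjoint_blinfun T)) \<xi>)"

text \<open>The measure \<open>y*m\<close>, with \<open>\<langle>y*m(A), x\<rangle> = \<langle>m(A)x, y*\<rangle>\<close>.\<close>

definition scalarization ::
    "'y::real_normed_vector dual \<Rightarrow>
     ('k set \<Rightarrow> 'x::real_normed_vector \<Rightarrow>\<^sub>L 'y dual dual) \<Rightarrow> 'k set \<Rightarrow> 'x dual" where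
  "scalarization y m A = canonical_embedding y o\<^sub>L m A"

lemma scalarization_apply:
  "blinfun_apply (scalarization y m A) x = blinfun_apply (blinfun_apply (m A) x) y"
  by (simp add: scalarization_def)

definition semivariation ::
    "('k::topological_space set \<Rightarrow> 'x::real_normed_vector \<Rightarrow>\<^sub>L 'y::real_normed_vector dual dual) \<Rightarrow>
     'k set \<Rightarrow> ennreal" where
  "semivariation m E = (SUP y\<in>{y. norm y \<le> 1}. variation (scalarization y m) E)"

definition strongly_bounded ::
    "('k::topological_space set \<Rightarrow> 'x::real_normed_vector \<Rightarrow>\<^sub>L 'y::real_normed_vector dual dual) \<Rightarrow>
     bool" where
  "strongly_bounded m \<longleftrightarrow>
     (\<forall>A::nat \<Rightarrow> 'k set. range A \<subseteq> sets borel \<longrightarrow> decseq A \<longrightarrow> (\<Inter>n. A n) = {} \<longrightarrow>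
        (\<lambda>n. semivariation m (A n)) \<longlonglongrightarrow> 0)"

section \<open>Limited sets and the classes of operators\<close>

text \<open>The supremum is taken in \<open>ennreal\<close>, so that it is \<open>0\<close> for the empty set.\<close>

definition limited :: "'e::real_normed_vector set \<Rightarrow> bool" where
  "limited A \<longleftrightarrow> bounded A \<and>
     (\<forall>\<phi> :: nat \<Rightarrow> 'e dual. (\<forall>x. (\<lambda>n. blinfun_apply (\<phi> n) x) \<longlonglongrightarrow> 0) \<longrightarrow>
        (\<lambda>n. SUP x\<in>A. ennreal \<bar>blinfun_apply (\<phi> n) x\<bar>) \<longlonglongrightarrow> 0)"

definition weakly_null :: "(nat \<Rightarrow> 'e::real_normed_vector) \<Rightarrow> bool" where
  "weakly_null x \<longleftrightarrow> (\<forall>\<phi> :: 'e dual. (\<lambda>n. blinfun_apply \<phi> (x n)) \<longlonglongrightarrow> 0)"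

definition weakly_p_summable :: "real \<Rightarrow> (nat \<Rightarrow> 'e::real_normed_vector) \<Rightarrow> bool" where
  "weakly_p_summable p x \<longleftrightarrow>
     (\<forall>\<phi> :: 'e dual. summable (\<lambda>n. \<bar>blinfun_apply \<phi> (x n)\<bar> powr p))"

definition limited_completely_continuous ::
    "('e::real_normed_vector \<Rightarrow>\<^sub>L 'f::real_normed_vector) \<Rightarrow> bool" where
  "limited_completely_continuous T \<longleftrightarrow>
     (\<forall>x. weakly_null x \<and> limited (range x) \<longrightarrow> (\<lambda>n. blinfun_apply T (x n)) \<longlonglongrightarrow> 0)"

definition limited_p_convergent ::
    "real \<Rightarrow> ('e::real_normed_vector \<Rightarrow>\<^sub>L 'f::real_normed_vector) \<Rightarrow> bool" where
  "limited_p_convergent p T \<longleftrightarrow>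
     (\<forall>x. weakly_p_summable p x \<and> limited (range x) \<longrightarrow> (\<lambda>n. blinfun_apply T (x n)) \<longlonglongrightarrow> 0)"

section \<open>Dispersed spaces\<close>

definition dispersed :: "'k::topological_space itself \<Rightarrow> bool" where
  "dispersed _ \<longleftrightarrow> (\<forall>S :: 'k set. closed S \<and> S \<noteq> {} \<longrightarrow> (\<exists>x. x isolated_in S))"

end

theory Submission
  imports Defs
begin

text \<open>On a dispersed compact space every functional \<open>\<phi>\<close> on \<open>C(K,X)\<close> is purely atomic: if the open
  sets on which \<open>\<phi>\<close> is concentrated, up to \<open>\<epsilon>\<close>, on finitely many points did not cover \<open>K\<close>, the
  complement of their union would have an isolated point, and a neighbourhood of that point would
  be such a set as well. So \<open>y*T(f) = \<Sum>t. y*m({t}) f(t)\<close>, with absolutely summable coefficients.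
  Strong boundedness makes the tails of these sums small uniformly in \<open>\<parallel>y*\<parallel> \<le> 1\<close>, whence \<open>T f\<close> is,
  up to \<open>\<epsilon> \<parallel>f\<parallel>\<close>, the sum of \<open>m({t}) f(t)\<close> over a finite set of points. Evaluation at \<open>t\<close> preserves
  limited weakly null and limited weakly \<open>p\<close>-summable sequences, and each \<open>m({t})\<close> maps these to norm
  null sequences.\<close>

text \<open>Two obstacles shape the proof. \<open>is_indicator_functional\<close> prescribes the
  value of a bidual element at a functional through a measure corresponding to it, so the atoms of
  \<open>m\<close> can be computed only once such a measure is at hand. The analysis is therefore
  carried out on the functional itself: variation on an open set is replaced by a bound tested on
  functions vanishing off that set, and the measure is written down when the functional is already
  known as a sum of atoms \<open>g t\<close>; it is \<open>infsum g\<close>, whose value at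
  \<open>{t}\<close> is \<open>g t\<close>. The other obstacle is that \<open>m {t}\<close> takes
  values in the bidual, while the hypothesis concerns \<open>into_predual (m {t})\<close>, a
  definite description that is informative only if those values lie in the canonical copy of the
  target space. The uniform smallness of the tails settles this too: it makes \<open>m {t} x\<close>
  a norm limit of values of \<open>T\<close>, and the copy is closed because the target is complete
  and, by the Hahn-Banach theorem, embedded isometrically.\<close>

section \<open>The Hahn-Banach theorem and the canonical embedding\<close>

text \<open>A minimal sublinear functional is linear: it coincides with each functional
  \<open>\<lambda>x. INF t\<ge>0. q (x + t v) - t q v\<close>, which lies below it.\<close>

definition sublinear :: "('a::real_vector \<Rightarrow> real) \<Rightarrow> bool" where
  "sublinear q \<longleftrightarrow> (\<forall>x y. q (x + y) \<le> q x + q y) \<and> (\<forall>c\<ge>0. \<forall>x. q (c *\<^sub>R x) = c * q x)"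

text \<open>The reverse inequality for \<open>c > 0\<close> is the second assumption with factor
  \<open>1 / c\<close> at the point \<open>c *\<^sub>R x\<close>.\<close>

lemma sublinearI:
  assumes "\<And>x y. q (x + y) \<le> q x + q y" "\<And>c x. 0 < c \<Longrightarrow> q (c *\<^sub>R x) \<le> c * q x" "q 0 = 0"
  shows "sublinear q"
  unfolding sublinear_def
proof (intro conjI allI impI)
  fix c :: real and x assume "0 \<le> c"
  show "q (c *\<^sub>R x) = c * q x"
  proof (cases "c = 0")
    case False
    with \<open>0 \<le> c\<close> have c: "0 < c" by simp
    have "q ((1 / c) *\<^sub>R (c *\<^sub>R x)) \<le> 1 / c * q (c *\<^sub>R x)"
      by (rule assms(2)) (use c in simp)
    with c have "c * q x \<le> q (c *\<^sub>R x)" by (simp add: field_simps)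
    with assms(2)[OF c, of x] show ?thesis by simp
  qed (simp add: assms(3))
qed (rule assms(1))

lemma sublinear_add: "sublinear q \<Longrightarrow> q (x + y) \<le> q x + q y"
  and sublinear_scale: "sublinear q \<Longrightarrow> 0 \<le> c \<Longrightarrow> q (c *\<^sub>R x) = c * q x"
  by (auto simp: sublinear_def)

lemma sublinear_zero: "sublinear q \<Longrightarrow> q 0 = 0"
  using sublinear_scale[of q 0 0] by simp

lemma sublinear_lower_bound: "sublinear q \<Longrightarrow> - q (- x) \<le> q x"
  using sublinear_add[of q x "- x"] sublinear_zero[of q] by simp

lemma sublinear_norm: "sublinear norm"
  by (rule sublinearI) (auto intro: norm_triangle_ineq)

text \<open>The last two properties are the term \<open>t = 1\<close> of the infimum. The bound at
  \<open>- v\<close> forces a linear functional below \<open>r\<close> to be at least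
  \<open>q v\<close> at \<open>v\<close>; the bound at arbitrary \<open>x\<close> yields additivity
  of a minimal \<open>q\<close>.\<close>

lemma sublinear_directional:
  assumes q: "sublinear q"
  shows "\<exists>r. sublinear r \<and> r \<le> q \<and> r (- v) \<le> - q v \<and> (\<forall>x. r x \<le> q (x + v) - q v)"
proof -
  define r where "r x = (INF t\<in>{0::real..}. q (x + t *\<^sub>R v) - t * q v)" for x
  \<comment> \<open>A bound independent of \<open>t\<close>; without one, the infimum over the reals
    would be an unspecified value.\<close>
  have lower: "- q (- x) \<le> q (x + t *\<^sub>R v) - t * q v" if "0 \<le> t" for t x
    using sublinear_add[OF q, of "x + t *\<^sub>R v" "- x"] sublinear_scale[OF q that, of v] by simp
  have r_le: "r x \<le> q (x + t *\<^sub>R v) - t * q v" if "0 \<le> t" for t x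
    unfolding r_def using that lower
    by (intro cINF_lower bdd_belowI2[where m = "- q (- x)"]) auto
  have r_ge: "a \<le> r x" if "\<And>t. 0 \<le> t \<Longrightarrow> a \<le> q (x + t *\<^sub>R v) - t * q v" for a x
    unfolding r_def using that by (intro cINF_greatest) auto
  have "sublinear r"
  proof (rule sublinearI)
    fix x y
    have "r (x + y) - r y \<le> q (x + s *\<^sub>R v) - s * q v" if s: "0 \<le> s" for s
    proof -
      have "r (x + y) - (q (x + s *\<^sub>R v) - s * q v) \<le> q (y + t *\<^sub>R v) - t * q v" if "0 \<le> t" for t
        using r_le[of "s + t" "x + y"] s that sublinear_add[OF q, of "x + s *\<^sub>R v" "y + t *\<^sub>R v"]
        by (simp add: algebra_simps)
      from r_ge[OF this] show ?thesis by simp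
    qed
    from r_ge[OF this] show "r (x + y) \<le> r x + r y" by simp
  next
    fix c :: real and x assume c: "0 < c"
    have "r (c *\<^sub>R x) / c \<le> q (x + t *\<^sub>R v) - t * q v" if "0 \<le> t" for t
      using r_le[of "c * t" "c *\<^sub>R x"] sublinear_scale[OF q, of c "x + t *\<^sub>R v"] c that
      by (simp add: field_simps)
    from r_ge[OF this] show "r (c *\<^sub>R x) \<le> c * r x" using c by (simp add: field_simps)
  next
    show "r 0 = 0"
      using r_le[of 0 0] sublinear_zero[OF q]
      by (intro antisym r_ge) (auto simp: sublinear_scale[OF q])
  qed
  moreover have "r \<le> q" using r_le[of 0] by (auto simp: le_fun_def)
  moreover have "r (- v) \<le> - q v" using r_le[of 1 "- v"] sublinear_zero[OF q] by simp
  moreover have "\<forall>x. r x \<le> q (x + v) - q v" using r_le[of 1] by simp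
  ultimately show ?thesis by blast
qed

text \<open>Subadditivity uses the chain: given \<open>q\<close> at \<open>x\<close> and
  \<open>r\<close> at \<open>y\<close>, the smaller of the two serves at both points. The function
  \<open>b\<close> keeps the infima finite.\<close>

lemma sublinear_INF_chain:
  assumes sub: "\<And>q. q \<in> C \<Longrightarrow> sublinear q" and "C \<noteq> {}"
    and chain: "\<And>q r. q \<in> C \<Longrightarrow> r \<in> C \<Longrightarrow> q \<le> r \<or> r \<le> q"
    and lower: "\<And>q x. q \<in> C \<Longrightarrow> b x \<le> q x"
  shows "sublinear (\<lambda>x. INF q\<in>C. q x)"
proof -
  define u where "u x = (INF q\<in>C. q x)" for x
  have u_le: "u x \<le> q x" if "q \<in> C" for q x
    unfolding u_def using that lower by (intro cINF_lower bdd_belowI2[where m = "b x"]) auto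
  have u_ge: "a \<le> u x" if "\<And>q. q \<in> C \<Longrightarrow> a \<le> q x" for a x
    unfolding u_def using that \<open>C \<noteq> {}\<close> by (intro cINF_greatest) auto
  have "sublinear u"
  proof (rule sublinearI)
    fix x y
    have "u (x + y) - u y \<le> q x" if q: "q \<in> C" for q
    proof -
      have *: "u (x + y) - q x \<le> r y" if r: "r \<in> C" for r
      proof -
        obtain w where w: "w \<in> C" "w x \<le> q x" "w y \<le> r y"
          using chain[OF q r] q r unfolding le_fun_def by blast
        show ?thesis
          using u_le[OF w(1), of "x + y"] sublinear_add[OF sub[OF w(1)], of x y] w(2,3) by linarith
      qed
      have "u (x + y) - q x \<le> u y" by (rule u_ge) (rule *)
      then show ?thesis by simp
    qed
    then have "u (x + y) - u y \<le> u x" by (rule u_ge)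
    then show "u (x + y) \<le> u x + u y" by simp
  next
    fix c :: real and x assume c: "0 < c"
    have "u (c *\<^sub>R x) / c \<le> q x" if "q \<in> C" for q
      using u_le[OF that, of "c *\<^sub>R x"] sublinear_scale[OF sub[OF that], of c x] c
      by (simp add: field_simps)
    then have "u (c *\<^sub>R x) / c \<le> u x" by (rule u_ge)
    then show "u (c *\<^sub>R x) \<le> c * u x" using c by (simp add: field_simps)
  next
    show "u 0 = 0"
      using \<open>C \<noteq> {}\<close> by (simp add: u_def sublinear_zero[OF sub] cong: INF_cong_simp)
  qed
  then show ?thesis unfolding u_def[abs_def] .
qed

lemma sublinear_dominates_linear:
  assumes q0: "sublinear (q0 :: 'a::real_vector \<Rightarrow> real)"
  shows "\<exists>f. linear f \<and> f \<le> q0"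
proof -
  define \<Q> where "\<Q> = {q. sublinear q \<and> q \<le> q0}"
  \<comment> \<open>The order is reversed, so that Zorn's lemma yields a minimal element.\<close>
  have po: "partial_order_on \<Q> (relation_of (\<lambda>q r. r \<le> q) \<Q>)"
    by (auto simp: partial_order_on_def preorder_on_def relation_of_def refl_on_def
        intro!: transI antisymI)
  have "\<exists>q\<in>\<Q>. \<forall>r\<in>\<Q>. r \<le> q \<longrightarrow> r = q"
  proof (rule predicate_Zorn[OF po])
    fix C assume "C \<in> Chains (relation_of (\<lambda>q r. r \<le> q) \<Q>)"
    then have C: "C \<subseteq> \<Q>" "\<And>q r. q \<in> C \<Longrightarrow> r \<in> C \<Longrightarrow> q \<le> r \<or> r \<le> q"
      by (auto simp: Chains_def relation_of_def)
    show "\<exists>u\<in>\<Q>. \<forall>q\<in>C. u \<le> q"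
    proof (cases "C = {}")
      case True
      with q0 show ?thesis by (auto simp: \<Q>_def)
    next
      case False
      have lower: "- q0 (- x) \<le> q x" if "q \<in> C" for q x
      proof -
        from that C(1) have "sublinear q" "q \<le> q0" by (auto simp: \<Q>_def)
        with sublinear_lower_bound[of q x] le_funD[of q q0 "- x"] show ?thesis by simp
      qed
      define u where "u x = (INF q\<in>C. q x)" for x
      have u_le: "u \<le> q" if "q \<in> C" for q
        unfolding u_def le_fun_def using that lower
        by (intro allI cINF_lower bdd_belowI2) auto
      have "sublinear u"
        unfolding u_def
        by (rule sublinear_INF_chain[where b = "\<lambda>x. - q0 (- x)"])
          (use False C lower in \<open>auto simp: \<Q>_def\<close>)
      moreover from False obtain q where "q \<in> C" by blast
      then have "u \<le> q0" using order_trans[OF u_le] C(1) by (auto simp: \<Q>_def)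
      ultimately have "u \<in> \<Q>" by (simp add: \<Q>_def)
      with u_le show ?thesis by blast
    qed
  qed
  then obtain q where q: "sublinear q" "q \<le> q0" and min: "\<And>r. sublinear r \<Longrightarrow> r \<le> q \<Longrightarrow> r = q"
    unfolding \<Q>_def by (metis (mono_tags, lifting) mem_Collect_eq order_trans)
  \<comment> \<open>Minimality gives \<open>r = q\<close>, and the third property of
    \<open>r\<close> becomes superadditivity of \<open>q\<close>.\<close>
  have add: "q (x + v) = q x + q v" for x v
  proof -
    obtain r where r: "sublinear r" "r \<le> q" "r x \<le> q (x + v) - q v"
      using sublinear_directional[OF q(1), of v] by blast
    from min[OF r(1,2)] r(3) sublinear_add[OF q(1), of x v] show ?thesis by simp
  qed
  have neg: "q (- x) = - q x" for x
    using add[of x "- x"] sublinear_zero[OF q(1)] by simp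
  have "linear q"
  proof (rule linearI)
    fix c x
    show "q (c *\<^sub>R x) = c *\<^sub>R q x"
      using sublinear_scale[OF q(1), of c x] sublinear_scale[OF q(1), of "- c" x] neg[of "c *\<^sub>R x"]
      by (cases "0 \<le> c") auto
  qed (rule add)
  with q(2) show ?thesis by blast
qed

text \<open>A linear functional below the norm alone could be zero. Placing it below the directional
  functional at \<open>x\<close> gives \<open>- f x \<le> - norm x\<close>, hence equality at
  \<open>x\<close>.\<close>

lemma norming_functional_exists:
  fixes x :: "'a::real_normed_vector"
  obtains f :: "'a dual" where "norm f \<le> 1" "blinfun_apply f x = norm x"
proof -
  obtain r where r: "sublinear r" "r \<le> norm" "r (- x) \<le> - norm x"
    using sublinear_directional[OF sublinear_norm, of x] by blast
  obtain f where f: "linear f" "f \<le> r" using sublinear_dominates_linear[OF r(1)] by blast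
  have le: "f z \<le> norm z" for z using le_funD[OF f(2), of z] le_funD[OF r(2), of z] by simp
  have bound: "\<bar>f z\<bar> \<le> norm z" for z
    using le[of z] le[of "- z"] linear_neg[OF f(1), of z] by auto
  have bl: "bounded_linear f"
    using f(1) bound by (intro bounded_linear_intro[where K = 1]) (auto simp: linear_add linear_scale)
  have "- f x \<le> - norm x"
    using le_funD[OF f(2), of "- x"] r(3) linear_neg[OF f(1), of x] by simp
  then have "f x = norm x" using le[of x] by simp
  moreover have "norm (Blinfun f) \<le> 1"
    using bound by (intro norm_blinfun_bound) (auto simp: bounded_linear_Blinfun_apply[OF bl])
  ultimately show ?thesis using that[of "Blinfun f"] by (simp add: bounded_linear_Blinfun_apply[OF bl])
qed

lemma norm_le_by_functionals:
  fixes x :: "'a::real_normed_vector"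
  assumes "\<And>f :: 'a dual. norm f \<le> 1 \<Longrightarrow> \<bar>blinfun_apply f x\<bar> \<le> c"
  shows "norm x \<le> c"
  using norming_functional_exists[of x] assms by (metis abs_norm_cancel)

lemma norm_canonical_embedding [simp]: "norm (canonical_embedding x) = norm x"
proof (rule antisym)
  show "norm (canonical_embedding x) \<le> norm x"
  proof (rule norm_blinfun_bound)
    fix f :: "'a dual"
    show "norm (blinfun_apply (canonical_embedding x) f) \<le> norm x * norm f"
      using norm_blinfun[of f x] by (simp add: mult.commute)
  qed simp
  show "norm x \<le> norm (canonical_embedding x)"
  proof (rule norm_le_by_functionals)
    fix f :: "'a dual" assume "norm f \<le> 1"
    then show "\<bar>blinfun_apply f x\<bar> \<le> norm (canonical_embedding x)"
      using norm_blinfun[of "canonical_embedding x" f]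
        mult_left_le[of "norm f" "norm (canonical_embedding x)"] by simp
  qed
qed

lemma linear_canonical_embedding: "linear canonical_embedding"
  by (rule linearI; rule blinfun_eqI) (simp_all add: blinfun.bilinear_simps)

lemma closed_range_canonical_embedding: "closed (range (canonical_embedding :: 'a::banach \<Rightarrow> _))"
proof -
  have "complete (range (canonical_embedding :: 'a \<Rightarrow> _))"
  proof (rule complete_isometric_image[where e = 1])
    show "bounded_linear (canonical_embedding :: 'a \<Rightarrow> _)"
      by (intro bounded_linear_intro[where K = 1])
        (simp_all add: linear_add linear_scale linear_canonical_embedding)
  qed (auto simp: complete_UNIV)
  then show ?thesis by (simp add: complete_imp_closed)
qed

text \<open>Isometry of the embedding gives everything \<open>THE\<close> asks for: injectivity
  makes the pointwise preimage unique and linear, and preservation of norms makes it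
  bounded.\<close>

lemma into_predual_apply:
  fixes S :: "'a::real_normed_vector \<Rightarrow>\<^sub>L 'b::real_normed_vector dual dual"
  assumes "\<And>x. blinfun_apply S x \<in> range canonical_embedding"
  shows "canonical_embedding (blinfun_apply (into_predual S) x) = blinfun_apply S x"
proof -
  have inj: "canonical_embedding a = canonical_embedding b \<Longrightarrow> a = b" for a b :: 'b
    using norm_canonical_embedding[of "a - b"] by (simp add: linear_diff linear_canonical_embedding)
  define R where "R x = (SOME y. blinfun_apply S x = canonical_embedding y)" for x
  have R: "blinfun_apply S x = canonical_embedding (R x)" for x
    unfolding R_def
    by (rule someI_ex[where P = "\<lambda>y. blinfun_apply S x = canonical_embedding y"])
      (use assms[of x] in auto)
  have "bounded_linear R"
  proof (rule bounded_linear_intro[where K = "norm S"])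
    fix x y c
    show "R (x + y) = R x + R y"
      by (rule inj) (simp add: linear_add[OF linear_canonical_embedding] R[symmetric] blinfun.bilinear_simps)
    show "R (c *\<^sub>R x) = c *\<^sub>R R x"
      by (rule inj) (simp add: linear_scale[OF linear_canonical_embedding] R[symmetric] blinfun.bilinear_simps)
    show "norm (R x) \<le> norm x * norm S"
      using norm_blinfun[of S x] by (simp add: R mult.commute)
  qed
  then have "\<forall>x. blinfun_apply S x = canonical_embedding (blinfun_apply (Blinfun R) x)"
    by (metis bounded_linear_Blinfun_apply R)
  moreover have "R' = R''"
    if "\<forall>x. blinfun_apply S x = canonical_embedding (blinfun_apply R' x)"
      and "\<forall>x. blinfun_apply S x = canonical_embedding (blinfun_apply R'' x)" for R' R''
    by (intro blinfun_eqI inj) (metis that)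
  ultimately have "\<exists>!R. \<forall>x. blinfun_apply S x = canonical_embedding (blinfun_apply R x)"
    by blast
  from theI'[OF this] show ?thesis unfolding into_predual_def by metis
qed

section \<open>Functionals on spaces of continuous functions\<close>

lemma apply_Bcontfun:
  fixes f :: "'k::topological_space \<Rightarrow> 'x::metric_space"
  assumes "compact (UNIV :: 'k set)" "continuous_on UNIV f"
  shows "apply_bcontfun (Bcontfun f) = f"
  using assms compact_imp_bounded[OF compact_continuous_image[of UNIV f]]
  by (intro Bcontfun_inverse) (auto simp: bcontfun_def)

lemma Urysohn_compact_t2:
  fixes S T :: "'k::t2_space set"
  assumes "compact (UNIV :: 'k set)" "closed S" "closed T" "S \<inter> T = {}"
  obtains h :: "'k \<Rightarrow> real" where "continuous_on UNIV h" "\<And>x. 0 \<le> h x" "\<And>x. h x \<le> 1"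
    "\<And>x. x \<in> S \<Longrightarrow> h x = 0" "\<And>x. x \<in> T \<Longrightarrow> h x = 1"
proof -
  have "Hausdorff_space (euclidean :: 'k topology)"
    by (simp add: Hausdorff_space_def disjnt_def) (metis hausdorff)
  then have "normal_space (euclidean :: 'k topology)"
    using assms(1) by (intro compact_Hausdorff_or_regular_imp_normal_space)
      (auto simp: compact_space_def)
  then obtain h :: "'k \<Rightarrow> real"
    where h: "continuous_map euclidean (top_of_set {0..1}) h" "h ` S \<subseteq> {0}" "h ` T \<subseteq> {1}"
    using Urysohn_lemma[of "euclidean :: 'k topology" S T 0 1] assms
    by (auto simp: disjnt_def)
  then have "continuous_on UNIV h" "\<And>x. h x \<in> {0..1}"
    by (auto simp: continuous_map_in_subtopology image_subset_iff)
  with h(2,3) show ?thesis by (intro that[of h]) auto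
qed

text \<open>A partial partition of unity: Urysohn functions are divided by \<open>max 1\<close> of
  their sum. On \<open>F\<close> this sum is exactly 1, so the prescribed values survive. The bound
  on the sum keeps combinations of vectors from the unit ball, weighted by the bumps, in the unit
  ball.\<close>

lemma bump_functions:
  fixes F :: "'k::t2_space set"
  assumes K: "compact (UNIV :: 'k set)" and F: "finite F"
  obtains h :: "'k \<Rightarrow> 'k \<Rightarrow> real" where
    "\<And>t. t \<in> F \<Longrightarrow> continuous_on UNIV (h t)" "\<And>t s. t \<in> F \<Longrightarrow> 0 \<le> h t s"
    "\<And>t. t \<in> F \<Longrightarrow> h t t = 1" "\<And>t s. t \<in> F \<Longrightarrow> s \<in> F \<Longrightarrow> s \<noteq> t \<Longrightarrow> h t s = 0"
    "\<And>s. (\<Sum>t\<in>F. h t s) \<le> 1"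
proof -
  have "\<exists>u :: 'k \<Rightarrow> real. continuous_on UNIV u \<and> (\<forall>s. 0 \<le> u s) \<and> u t = 1 \<and> (\<forall>s\<in>F - {t}. u s = 0)"
    if "t \<in> F" for t
  proof -
    have "closed (F - {t})" using F by (intro finite_imp_closed) auto
    then obtain u :: "'k \<Rightarrow> real" where "continuous_on UNIV u" "\<And>x. 0 \<le> u x" "\<And>x. u x \<le> 1"
      "\<And>x. x \<in> F - {t} \<Longrightarrow> u x = 0" "\<And>x. x \<in> {t} \<Longrightarrow> u x = 1"
      by (rule Urysohn_compact_t2[OF K _ closed_singleton]) auto
    then show ?thesis by (intro exI[of _ u]) simp
  qed
  then obtain u :: "'k \<Rightarrow> 'k \<Rightarrow> real" where
    u: "\<And>t. t \<in> F \<Longrightarrow> continuous_on UNIV (u t)" "\<And>t s. t \<in> F \<Longrightarrow> 0 \<le> u t s"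
      "\<And>t. t \<in> F \<Longrightarrow> u t t = 1" "\<And>t s. t \<in> F \<Longrightarrow> s \<in> F - {t} \<Longrightarrow> u t s = 0"
    by metis
  define N where "N s = max 1 (\<Sum>t\<in>F. u t s)" for s
  have N: "continuous_on UNIV N" "\<And>s. 1 \<le> N s" "\<And>s. (\<Sum>t\<in>F. u t s) \<le> N s"
    unfolding N_def by (auto intro!: continuous_intros u)
  have N0: "N s \<noteq> 0" for s using N(2)[of s] by linarith
  have "N s = 1" if "s \<in> F" for s
  proof -
    have "(\<Sum>t\<in>F. u t s) = (\<Sum>t\<in>F. if t = s then 1 else 0)"
      using that u(3,4) by (intro sum.cong) auto
    then show ?thesis using that F by (simp add: N_def)
  qed
  then have N1: "\<And>s. s \<in> F \<Longrightarrow> N s = 1" .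
  show ?thesis
  proof (rule that[of "\<lambda>t s. u t s / N s"])
    show "(\<Sum>t\<in>F. u t s / N s) \<le> 1" for s
      using N(2,3)[of s] by (simp add: sum_divide_distrib[symmetric] divide_le_eq_1)
    show "0 \<le> u t s / N s" if "t \<in> F" for t s
      using u(2)[OF that, of s] N(2)[of s] by (intro divide_nonneg_pos) auto
  qed (use u N N0 N1 in \<open>auto intro!: continuous_intros\<close>)
qed

text \<open>Soft thresholding by the factor \<open>1 - d / max d (norm (f t))\<close>. It replaces a
  function vanishing off an open set by a nearby one vanishing off the closed set where
  \<open>norm (f t) \<ge> d\<close>.\<close>

lemma truncate_bcontfun:
  fixes f :: "'k::topological_space \<Rightarrow>\<^sub>C 'x::real_normed_vector"
  assumes K: "compact (UNIV :: 'k set)" and d: "0 < d"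
  obtains g :: "'k \<Rightarrow>\<^sub>C 'x" where "\<And>t. norm (g t) \<le> norm (f t)"
    "\<And>t. norm (f t) \<le> d \<Longrightarrow> g t = 0" "norm (f - g) \<le> d"
proof -
  define c where "c t = 1 - d / max d (norm (f t))" for t
  have pos: "0 < max d (norm (f t))" for t using d by simp
  then have "continuous_on UNIV c"
    unfolding c_def by (intro continuous_intros) (auto simp: less_le)
  then have g: "apply_bcontfun (Bcontfun (\<lambda>t. c t *\<^sub>R f t)) = (\<lambda>t. c t *\<^sub>R f t)" (is "apply_bcontfun ?g = _")
    by (intro apply_Bcontfun K continuous_intros) auto
  have c: "0 \<le> c t" "c t \<le> 1" for t
    using d pos[of t] by (auto simp: c_def divide_le_eq_1)
  have "norm (f t - c t *\<^sub>R f t) \<le> d" for t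
  proof -
    have "f t - c t *\<^sub>R f t = (1 - c t) *\<^sub>R f t" by (simp add: algebra_simps)
    then have "norm (f t - c t *\<^sub>R f t) = (1 - c t) * norm (f t)" using c(2)[of t] by simp
    also have "\<dots> = d * norm (f t) / max d (norm (f t))" by (simp add: c_def)
    also have "\<dots> \<le> d" using d pos[of t] by (simp add: divide_le_eq mult_left_mono)
    finally show ?thesis .
  qed
  then have "norm (f - ?g) \<le> d" by (intro norm_bound) (simp add: g)
  moreover have "norm (?g t) \<le> norm (f t)" for t
    using c[of t] by (simp add: g mult_left_le_one_le)
  moreover have "?g t = 0" if "norm (f t) \<le> d" for t
    unfolding g using that d by (simp add: c_def max_absorb1)
  ultimately show ?thesis by (rule that[rotated 2])
qed

section \<open>Functionals small on open sets\<close>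

text \<open>\<open>small \<phi> U e\<close> says that the variation of the measure behind \<open>\<phi>\<close> is at most \<open>e\<close> on the
  open set \<open>U\<close>.\<close>

definition small ::
    "('k::topological_space \<Rightarrow>\<^sub>C 'x::real_normed_vector) dual \<Rightarrow> 'k set \<Rightarrow> real \<Rightarrow> bool" where
  "small \<phi> U e \<longleftrightarrow>
     0 \<le> e \<and> (\<forall>f. (\<forall>t. t \<notin> U \<longrightarrow> apply_bcontfun f t = 0) \<longrightarrow> \<bar>blinfun_apply \<phi> f\<bar> \<le> e * norm f)"

lemma smallD:
  "small \<phi> U e \<Longrightarrow> (\<And>t. t \<notin> U \<Longrightarrow> apply_bcontfun f t = 0) \<Longrightarrow> \<bar>blinfun_apply \<phi> f\<bar> \<le> e * norm f"
  by (auto simp: small_def)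

lemma small_bound:
  assumes "small \<phi> U e" "\<And>t. t \<notin> U \<Longrightarrow> apply_bcontfun f t = 0" "norm f \<le> c"
  shows "\<bar>blinfun_apply \<phi> f\<bar> \<le> e * c"
  using smallD[OF assms(1,2)] mult_left_mono[OF assms(3), of e] assms(1) by (auto simp: small_def)

lemma small_mono: "small \<phi> U e \<Longrightarrow> V \<subseteq> U \<Longrightarrow> e \<le> e' \<Longrightarrow> small \<phi> V e'"
  unfolding small_def by (meson mult_right_mono norm_ge_zero order_trans subsetD)

text \<open>Subadditivity of variation. After truncation the function vanishes off a closed
  \<open>C\<close> inside \<open>U \<union> V\<close>; the sets \<open>C - U\<close> and
  \<open>C - V\<close> are closed and disjoint, and a Urysohn function for them splits it into a
  part vanishing off \<open>U\<close> and a part vanishing off \<open>V\<close>.\<close>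

lemma small_Un:
  fixes \<phi> :: "('k::t2_space \<Rightarrow>\<^sub>C 'x::real_normed_vector) dual"
  assumes K: "compact (UNIV :: 'k set)" and "open U" "open V" and U: "small \<phi> U a" and V: "small \<phi> V b"
  shows "small \<phi> (U \<union> V) (a + b)"
  unfolding small_def
proof (intro conjI allI impI)
  show "0 \<le> a + b" using U V by (simp add: small_def)
  fix f :: "'k \<Rightarrow>\<^sub>C 'x" assume f: "\<forall>t. t \<notin> U \<union> V \<longrightarrow> apply_bcontfun f t = 0"
  show "\<bar>blinfun_apply \<phi> f\<bar> \<le> (a + b) * norm f"
  proof (rule field_le_epsilon)
    fix e :: real assume e: "0 < e"
    \<comment> \<open>Chosen so that truncation at height \<open>d\<close> changes the value of
      \<open>\<phi>\<close> by at most \<open>e\<close>; the 1 covers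
      \<open>\<phi> = 0\<close>.\<close>
    define d where "d = e / (norm \<phi> + 1)"
    have n: "0 < norm \<phi> + 1" using norm_ge_zero[of \<phi>] by linarith
    have d: "0 < d" using e n by (simp add: d_def)
    obtain g :: "'k \<Rightarrow>\<^sub>C 'x" where g: "\<And>t. norm (g t) \<le> norm (f t)"
      "\<And>t. norm (f t) \<le> d \<Longrightarrow> g t = 0" "norm (f - g) \<le> d"
      using truncate_bcontfun[OF K d, of f] by blast
    define C where "C = {t. d \<le> norm (f t)}"
    have C: "closed C" unfolding C_def by (intro closed_Collect_le continuous_intros) auto
    have "C \<subseteq> U \<union> V" using f d by (force simp: C_def)
    then have "(C - U) \<inter> (C - V) = {}" by blast
    then obtain h :: "'k \<Rightarrow> real" where h: "continuous_on UNIV h" "\<And>x. 0 \<le> h x" "\<And>x. h x \<le> 1"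
      "\<And>x. x \<in> C - U \<Longrightarrow> h x = 0" "\<And>x. x \<in> C - V \<Longrightarrow> h x = 1"
      using Urysohn_compact_t2[OF K closed_Diff[OF C \<open>open U\<close>] closed_Diff[OF C \<open>open V\<close>]] by blast
    define g1 where "g1 = Bcontfun (\<lambda>t. h t *\<^sub>R g t)"
    have g1: "apply_bcontfun g1 = (\<lambda>t. h t *\<^sub>R g t)"
      unfolding g1_def by (intro apply_Bcontfun K continuous_intros h) auto
    have gC: "g t = 0" if "t \<notin> C" for t using that g(2)[of t] by (simp add: C_def)
    have gf: "norm (g t) \<le> norm f" for t using g(1)[of t] norm_bounded[of f t] by linarith
    have "\<bar>blinfun_apply \<phi> g1\<bar> \<le> a * norm f"
    proof (rule small_bound[OF U])
      show "apply_bcontfun g1 t = 0" if "t \<notin> U" for t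
        using that h(4)[of t] gC[of t] by (cases "t \<in> C") (auto simp: g1)
      have "h t * norm (g t) \<le> norm f" for t
        using gf[of t] mult_left_le_one_le[of "norm (g t)" "h t"] h(2,3)[of t] by simp
      then show "norm g1 \<le> norm f" using h(2) by (intro norm_bound) (simp add: g1)
    qed
    moreover have "\<bar>blinfun_apply \<phi> (g - g1)\<bar> \<le> b * norm f"
    proof (rule small_bound[OF V])
      show "apply_bcontfun (g - g1) t = 0" if "t \<notin> V" for t
        using that h(5)[of t] gC[of t] by (cases "t \<in> C") (auto simp: g1)
      have "norm (g t - h t *\<^sub>R g t) \<le> norm f" for t
      proof -
        have "g t - h t *\<^sub>R g t = (1 - h t) *\<^sub>R g t" by (simp add: algebra_simps)
        then have "norm (g t - h t *\<^sub>R g t) = (1 - h t) * norm (g t)" using h(3)[of t] by simp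
        with gf[of t] mult_left_le_one_le[of "norm (g t)" "1 - h t"] h(2,3)[of t] show ?thesis by simp
      qed
      then show "norm (g - g1) \<le> norm f" by (intro norm_bound) (simp add: g1)
    qed
    moreover have "\<bar>blinfun_apply \<phi> (f - g)\<bar> \<le> e"
    proof -
      have "\<bar>blinfun_apply \<phi> (f - g)\<bar> \<le> norm \<phi> * norm (f - g)"
        using norm_blinfun[of \<phi> "f - g"] by simp
      also have "\<dots> \<le> (norm \<phi> + 1) * d" using g(3) d by (intro mult_mono) auto
      finally show ?thesis using n by (simp add: d_def)
    qed
    moreover have "blinfun_apply \<phi> f =
        blinfun_apply \<phi> g1 + blinfun_apply \<phi> (g - g1) + blinfun_apply \<phi> (f - g)"
      by (simp add: blinfun.bilinear_simps)
    ultimately show "\<bar>blinfun_apply \<phi> f\<bar> \<le> (a + b) * norm f + e"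
      by (simp add: algebra_simps)
  qed
qed

text \<open>A truncation of a function that nearly attains the variation on \<open>D\<close> leaves no room for
  another function with disjoint support.\<close>

lemma small_outside_closed:
  fixes \<phi> :: "('k::t2_space \<Rightarrow>\<^sub>C 'x::real_normed_vector) dual"
  assumes K: "compact (UNIV :: 'k set)" and e: "0 < e"
  obtains C where "closed C" "C \<subseteq> D" "small \<phi> (D - C) e"
proof -
  define B where "B = {f :: 'k \<Rightarrow>\<^sub>C 'x. norm f \<le> 1 \<and> (\<forall>t. t \<notin> D \<longrightarrow> apply_bcontfun f t = 0)}"
  have bound: "blinfun_apply \<phi> f \<le> norm \<phi>" if "f \<in> B" for f
    using that norm_blinfun[of \<phi> f] mult_left_le[of "norm f" "norm \<phi>"] by (simp add: B_def)
  have bdd: "bdd_above (blinfun_apply \<phi> ` B)" using bound by (intro bdd_aboveI2)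
  have "0 \<in> B" by (simp add: B_def)
  define s where "s = (SUP f\<in>B. blinfun_apply \<phi> f)"
  have s: "blinfun_apply \<phi> f \<le> s" if "f \<in> B" for f
    unfolding s_def using that bdd by (rule cSUP_upper)
  have "s - e / 2 < s" using e by simp
  then obtain f where f: "f \<in> B" "s - e / 2 < blinfun_apply \<phi> f"
    unfolding s_def using less_cSUP_iff[OF _ bdd] \<open>0 \<in> B\<close> by (metis empty_iff)
  \<comment> \<open>Half of \<open>e\<close> was spent on missing the supremum, the other half pays
    for the truncation.\<close>
  define d where "d = (e / 2) / (norm \<phi> + 1)"
  have n: "0 < norm \<phi> + 1" using norm_ge_zero[of \<phi>] by linarith
  have d: "0 < d" using e n by (simp add: d_def)
  obtain g :: "'k \<Rightarrow>\<^sub>C 'x" where g: "\<And>t. norm (g t) \<le> norm (f t)"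
    "\<And>t. norm (f t) \<le> d \<Longrightarrow> g t = 0" "norm (f - g) \<le> d"
    using truncate_bcontfun[OF K d, of f] by blast
  define C where "C = {t. d \<le> norm (f t)}"
  have "closed C" unfolding C_def by (intro closed_Collect_le continuous_intros) auto
  moreover have "C \<subseteq> D" using f(1) d by (force simp: C_def B_def)
  moreover have "small \<phi> (D - C) e"
    unfolding small_def
  proof (intro conjI allI impI)
    fix u :: "'k \<Rightarrow>\<^sub>C 'x" assume u: "\<forall>t. t \<notin> D - C \<longrightarrow> apply_bcontfun u t = 0"
    have "\<bar>blinfun_apply \<phi> (f - g)\<bar> \<le> norm \<phi> * norm (f - g)"
      using norm_blinfun[of \<phi> "f - g"] by simp
    also have "\<dots> \<le> (norm \<phi> + 1) * d" using g(3) d by (intro mult_mono) auto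
    also have "\<dots> = e / 2"
      unfolding d_def using n by (metis less_irrefl nonzero_mult_div_cancel_left times_divide_eq_right)
    finally have fg: "s - e < blinfun_apply \<phi> g"
      using f(2) unfolding blinfun.diff_right by linarith
    have *: "blinfun_apply \<phi> v \<le> e" if v: "norm v \<le> 1" "\<And>t. t \<notin> D - C \<Longrightarrow> v t = 0"
      for v :: "'k \<Rightarrow>\<^sub>C 'x"
    proof -
      \<comment> \<open>On \<open>C\<close> the function \<open>v\<close> vanishes and off
        \<open>C\<close> the truncation \<open>g\<close> does, so the norms never add up.\<close>
      have "norm (g t + v t) \<le> 1" for t
      proof (cases "t \<in> C")
        case True
        then have "norm (g t + v t) \<le> norm (f t)" using v(2)[of t] g(1)[of t] by simp
        also have "\<dots> \<le> 1" using norm_bounded[of f t] f(1) by (simp add: B_def)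
        finally show ?thesis .
      next
        case False
        then have "g t = 0" using g(2)[of t] by (simp add: C_def)
        with v(1) norm_bounded[of v t] show ?thesis by simp
      qed
      then have "norm (g + v) \<le> 1" by (intro norm_bound) simp
      moreover have "(g + v) t = 0" if "t \<notin> D" for t
        using that v(2)[of t] g(1)[of t] f(1) by (simp add: B_def)
      ultimately have "g + v \<in> B" by (simp add: B_def)
      from s[OF this] fg show ?thesis by (simp add: blinfun.bilinear_simps)
    qed
    show "\<bar>blinfun_apply \<phi> u\<bar> \<le> e * norm u"
    proof (cases "u = 0")
      case False
      then have n: "0 < norm u" by simp
      have "c * blinfun_apply \<phi> u / norm u \<le> e" if "\<bar>c\<bar> = 1" for c
        using *[of "(c / norm u) *\<^sub>R u"] u n that by (simp add: blinfun.scaleR_right)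
      from this[of 1] this[of "- 1"] show ?thesis
        using n by (simp add: divide_le_eq minus_divide_le_eq abs_le_iff)
    qed simp
  qed (use e in simp)
  ultimately show ?thesis by (rule that)
qed

section \<open>Atomic functionals and their series\<close>

definition atomic_on ::
    "('k::topological_space \<Rightarrow>\<^sub>C 'x::real_normed_vector) dual \<Rightarrow> 'k set \<Rightarrow> bool" where
  "atomic_on \<phi> U \<longleftrightarrow> (\<forall>e>0. \<exists>F. finite F \<and> small \<phi> (U - F) e)"

lemma atomic_on_empty:
  fixes \<phi> :: "('k::topological_space \<Rightarrow>\<^sub>C 'x::real_normed_vector) dual"
  shows "atomic_on \<phi> {}"
proof -
  have "small \<phi> {} e" if "0 < e" for e
    unfolding small_def
  proof (intro conjI allI impI)
    fix f :: "'k \<Rightarrow>\<^sub>C 'x" assume "\<forall>t. t \<notin> {} \<longrightarrow> apply_bcontfun f t = 0"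
    then have "f = 0" by (intro bcontfun_eqI) simp
    then show "\<bar>blinfun_apply \<phi> f\<bar> \<le> e * norm f" by simp
  qed (use that in simp)
  then show ?thesis by (auto simp: atomic_on_def)
qed

lemma atomic_on_Un:
  fixes \<phi> :: "('k::t2_space \<Rightarrow>\<^sub>C 'x::real_normed_vector) dual"
  assumes K: "compact (UNIV :: 'k set)" and "open U" "open V" "atomic_on \<phi> U" "atomic_on \<phi> V"
  shows "atomic_on \<phi> (U \<union> V)"
  unfolding atomic_on_def
proof (intro allI impI)
  fix e :: real assume "0 < e"
  then have "0 < e / 2" by simp
  with assms(4,5) obtain F G where F: "finite F" "small \<phi> (U - F) (e / 2)"
    and G: "finite G" "small \<phi> (V - G) (e / 2)" unfolding atomic_on_def by blast
  have "small \<phi> ((U - F) \<union> (V - G)) (e / 2 + e / 2)"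
    using F G assms by (intro small_Un open_Diff finite_imp_closed)
  then have "small \<phi> (U \<union> V - (F \<union> G)) e" by (rule small_mono) auto
  with F(1) G(1) show "\<exists>F. finite F \<and> small \<phi> (U \<union> V - F) e" by blast
qed

lemma atomic_on_Union:
  fixes \<phi> :: "('k::t2_space \<Rightarrow>\<^sub>C 'x::real_normed_vector) dual"
  assumes "compact (UNIV :: 'k set)" "finite \<U>" "\<And>U. U \<in> \<U> \<Longrightarrow> open U \<and> atomic_on \<phi> U"
  shows "atomic_on \<phi> (\<Union>\<U>)"
  using assms(2,3)
proof (induction \<U>)
  case (insert U \<U>)
  then have "atomic_on \<phi> (U \<union> \<Union>\<U>)" by (intro atomic_on_Un assms(1)) auto
  then show ?case by simp
qed (simp add: atomic_on_empty)

text \<open>The difficulty is a neighbourhood \<open>T\<close> of the isolated point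
  \<open>t\<close>: \<open>T - {t}\<close> is covered by members of \<open>\<W>\<close>, but perhaps
  not by finitely many. \<open>small_outside_closed\<close> acts as inner regularity and gives a
  closed, hence compact, \<open>C\<close> inside \<open>T - {t}\<close> that misses only mass
  \<open>e / 2\<close>; finitely many members cover \<open>C\<close>.\<close>

lemma dispersed_imp_atomic:
  fixes \<phi> :: "('k::t2_space \<Rightarrow>\<^sub>C 'x::real_normed_vector) dual"
  assumes K: "compact (UNIV :: 'k set)" and "dispersed TYPE('k)"
  shows "atomic_on \<phi> UNIV"
proof -
  define \<W> where "\<W> = {U. open U \<and> atomic_on \<phi> U}"
  have cover: "\<exists>\<U>. \<U> \<subseteq> \<W> \<and> finite \<U> \<and> C \<subseteq> \<Union>\<U>" if "C \<subseteq> \<Union>\<W>" "closed C" for C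
  proof -
    have "compact C" using compact_Int_closed[OF K that(2)] by simp
    then show ?thesis using that(1) by (rule compactE) (auto simp: \<W>_def)
  qed
  have "\<Union>\<W> = UNIV"
  proof (rule ccontr)
    assume "\<Union>\<W> \<noteq> UNIV"
    moreover have "closed (- \<Union>\<W>)" by (auto simp: \<W>_def)
    ultimately obtain t where "t isolated_in (- \<Union>\<W>)"
      using \<open>dispersed TYPE('k)\<close> unfolding dispersed_def by blast
    then obtain T where t: "t \<notin> \<Union>\<W>" and T: "open T" "T \<inter> - \<Union>\<W> = {t}"
      by (auto simp: isolated_in_def)
    have "atomic_on \<phi> T"
      unfolding atomic_on_def
    proof (intro allI impI)
      fix e :: real assume "0 < e"
      then have e: "0 < e / 2" by simp
      obtain C where C: "closed C" "C \<subseteq> T - {t}" "small \<phi> (T - {t} - C) (e / 2)"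
        using small_outside_closed[OF K e] by blast
      have "C \<subseteq> \<Union>\<W>" using C(2) T(2) by blast
      from cover[OF this C(1)] obtain \<U> where \<U>: "\<U> \<subseteq> \<W>" "finite \<U>" "C \<subseteq> \<Union>\<U>" by blast
      then have "atomic_on \<phi> (\<Union>\<U>)" by (intro atomic_on_Union K) (auto simp: \<W>_def)
      then obtain F where F: "finite F" "small \<phi> (\<Union>\<U> - F) (e / 2)"
        using e unfolding atomic_on_def by blast
      have op: "open (\<Union>\<U> - F)" using \<U>(1) F(1) by (auto simp: \<W>_def intro!: open_Diff finite_imp_closed)
      have "open (T - {t} - C)" using T(1) C(1) by (intro open_Diff) auto
      from small_Un[OF K this op C(3) F(2)]
      have "small \<phi> ((T - {t} - C) \<union> (\<Union>\<U> - F)) (e / 2 + e / 2)" .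
      \<comment> \<open>The point \<open>t\<close> itself joins the finite exceptional set.\<close>
      then have "small \<phi> (T - insert t F) e" by (rule small_mono) (use \<U>(3) in auto)
      with F(1) show "\<exists>F. finite F \<and> small \<phi> (T - F) e" by blast
    qed
    with T(1) have "T \<in> \<W>" by (simp add: \<W>_def)
    with t T(2) show False by blast
  qed
  with cover[of UNIV] obtain \<U> where "\<U> \<subseteq> \<W>" "finite \<U>" "\<Union>\<U> = UNIV" by auto
  then show ?thesis using atomic_on_Union[OF K, of \<U> \<phi>] by (auto simp: \<W>_def)
qed

text \<open>The mass of \<open>\<phi>\<close> at \<open>t\<close> is the limit of the functionals \<open>\<lambda>x. \<phi> (h x)\<close> over functions \<open>h\<close>
  concentrating at \<open>t\<close>. Two such functions are compared through their product.\<close>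

lemma atom_exists:
  fixes \<phi> :: "('k::t2_space \<Rightarrow>\<^sub>C 'x::real_normed_vector) dual"
  assumes K: "compact (UNIV :: 'k set)" and \<phi>: "atomic_on \<phi> UNIV"
  shows "\<exists>g :: 'x dual. \<forall>F e h x. small \<phi> (- F) e \<longrightarrow> continuous_on UNIV h \<longrightarrow>
    (\<forall>s. 0 \<le> h s \<and> h s \<le> 1) \<longrightarrow> h t = 1 \<longrightarrow> (\<forall>s\<in>F - {t}. h s = 0) \<longrightarrow>
    \<bar>blinfun_apply \<phi> (Bcontfun (\<lambda>s. h s *\<^sub>R x)) - blinfun_apply g x\<bar> \<le> e * norm x"
proof -
  define good where "good F e h \<longleftrightarrow> small \<phi> (- F) e \<and> continuous_on UNIV h \<and>
    (\<forall>s. 0 \<le> h s \<and> h s \<le> 1) \<and> h t = (1::real) \<and> (\<forall>s\<in>F - {t}. h s = 0)" for F e h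
  define \<psi> where "\<psi> h x = blinfun_apply \<phi> (Bcontfun (\<lambda>s. h s *\<^sub>R x))" for h x
  have app: "apply_bcontfun (Bcontfun (\<lambda>s. h s *\<^sub>R x)) = (\<lambda>s. h s *\<^sub>R x)"
    if "continuous_on UNIV h" for h :: "'k \<Rightarrow> real" and x :: 'x
    using that by (intro apply_Bcontfun K continuous_intros)
  \<comment> \<open>The difference \<open>h - h * u\<close> vanishes on \<open>F\<close>: there
    \<open>h\<close> is zero except possibly at \<open>t\<close>, where \<open>u\<close> is 1. Hence
    the constant is the one attached to \<open>h\<close>; exchanging the roles gives the one
    attached to \<open>u\<close>.\<close>
  have \<psi>_diff: "\<bar>\<psi> h x - \<psi> (\<lambda>s. h s * u s) x\<bar> \<le> e * norm x"
    if h: "good F e h" and u: "good G c u" for F e h G c u x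
  proof -
    have cont: "continuous_on UNIV h" "continuous_on UNIV u" "continuous_on UNIV (\<lambda>s. h s * u s)"
      using h u by (auto simp: good_def intro!: continuous_intros)
    have "\<bar>blinfun_apply \<phi> (Bcontfun (\<lambda>s. h s *\<^sub>R x) - Bcontfun (\<lambda>s. (h s * u s) *\<^sub>R x))\<bar> \<le> e * norm x"
    proof (rule small_bound)
      show "small \<phi> (- F) e" using h by (simp add: good_def)
      show "apply_bcontfun (Bcontfun (\<lambda>s. h s *\<^sub>R x) - Bcontfun (\<lambda>s. (h s * u s) *\<^sub>R x)) s = 0"
        if "s \<notin> - F" for s
        using that h u by (cases "s = t") (auto simp: app cont good_def)
      have "norm (h s *\<^sub>R x - (h s * u s) *\<^sub>R x) \<le> norm x" for s
      proof -
        have hu: "0 \<le> h s" "h s \<le> 1" "0 \<le> u s" "u s \<le> 1" using h u by (auto simp: good_def)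
        have "h s *\<^sub>R x - (h s * u s) *\<^sub>R x = (h s * (1 - u s)) *\<^sub>R x" by (simp add: algebra_simps)
        then have "norm (h s *\<^sub>R x - (h s * u s) *\<^sub>R x) = (h s * (1 - u s)) * norm x"
          using hu by simp
        also have "\<dots> \<le> 1 * norm x" using hu by (intro mult_right_mono mult_le_one) auto
        finally show ?thesis by simp
      qed
      then show "norm (Bcontfun (\<lambda>s. h s *\<^sub>R x) - Bcontfun (\<lambda>s. (h s * u s) *\<^sub>R x)) \<le> norm x"
        by (intro norm_bound) (simp add: app cont)
    qed
    then show ?thesis by (simp add: \<psi>_def blinfun.bilinear_simps)
  qed
  have compare: "\<bar>\<psi> h x - \<psi> u x\<bar> \<le> (e + c) * norm x" if "good F e h" "good G c u" for F e h G c u x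
    using \<psi>_diff[OF that, of x] \<psi>_diff[OF that(2,1), of x] by (simp add: algebra_simps abs_le_iff)
  have bl: "bounded_linear (\<psi> h)" if cont: "continuous_on UNIV h" "\<And>s. 0 \<le> h s \<and> h s \<le> 1" for h
  proof (rule bounded_linear_intro[where K = "norm \<phi>"])
    fix x y :: 'x and r
    have "Bcontfun (\<lambda>s. h s *\<^sub>R (x + y)) = Bcontfun (\<lambda>s. h s *\<^sub>R x) + Bcontfun (\<lambda>s. h s *\<^sub>R y)"
      by (rule bcontfun_eqI, unfold plus_bcontfun.rep_eq app[OF cont(1)], rule scaleR_add_right)
    then show "\<psi> h (x + y) = \<psi> h x + \<psi> h y" by (simp add: \<psi>_def blinfun.bilinear_simps)
    have "Bcontfun (\<lambda>s. h s *\<^sub>R (r *\<^sub>R x)) = r *\<^sub>R Bcontfun (\<lambda>s. h s *\<^sub>R x)"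
      by (rule bcontfun_eqI, unfold scaleR_bcontfun.rep_eq app[OF cont(1)], rule scaleR_left_commute)
    then show "\<psi> h (r *\<^sub>R x) = r *\<^sub>R \<psi> h x" by (simp add: \<psi>_def blinfun.bilinear_simps)
    have "norm (Bcontfun (\<lambda>s. h s *\<^sub>R x)) \<le> norm x"
      using cont by (intro norm_bound) (simp add: app mult_left_le_one_le)
    then show "norm (\<psi> h x) \<le> norm x * norm \<phi>"
      using order_trans[OF norm_blinfun[of \<phi> "Bcontfun (\<lambda>s. h s *\<^sub>R x)"] mult_left_mono]
      by (simp add: \<psi>_def mult.commute)
  qed
  have "\<exists>F h. good F e h" if e: "0 < e" for e
  proof -
    obtain F where F: "finite F" "small \<phi> (UNIV - F) e" using \<phi> e unfolding atomic_on_def by blast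
    obtain h :: "'k \<Rightarrow> real" where "continuous_on UNIV h" "\<And>x. 0 \<le> h x" "\<And>x. h x \<le> 1"
      "\<And>x. x \<in> F - {t} \<Longrightarrow> h x = 0" "\<And>x. x \<in> {t} \<Longrightarrow> h x = 1"
      by (rule Urysohn_compact_t2[OF K, of "F - {t}" "{t}"]) (use F(1) in \<open>auto intro: finite_imp_closed\<close>)
    with F(2) have "good F e h" by (auto simp: good_def Compl_eq_Diff_UNIV)
    then show ?thesis by blast
  qed
  \<comment> \<open>The comparison is uniform over the unit ball of \<open>X\<close>, so these
    functionals are Cauchy in the norm of the dual; \<open>compare\<close> passes to the limit for
    every admissible \<open>u\<close>.\<close>
  then have "\<forall>n. \<exists>F h. good F (inverse (real (Suc n))) h" by simp
  then obtain F h where gd: "\<And>n. good (F n) (inverse (real (Suc n))) (h n)" by metis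
  define G where "G n = Blinfun (\<psi> (h n))" for n
  have G: "blinfun_apply (G n) x = \<psi> (h n) x" for n x
    unfolding G_def using gd[of n] by (subst bounded_linear_Blinfun_apply[OF bl]) (auto simp: good_def)
  have "Cauchy G"
  proof (rule CauchyI)
    fix r :: real assume "0 < r"
    then obtain M where M: "inverse (real (Suc M)) < r / 2" using reals_Archimedean[of "r / 2"] by auto
    show "\<exists>M. \<forall>m\<ge>M. \<forall>n\<ge>M. norm (G m - G n) < r"
    proof (intro exI allI impI)
      fix m n assume mn: "M \<le> m" "M \<le> n"
      have "norm (G m - G n) \<le> inverse (real (Suc m)) + inverse (real (Suc n))"
      proof (rule norm_blinfun_bound)
        show "norm (blinfun_apply (G m - G n) x) \<le> (inverse (real (Suc m)) + inverse (real (Suc n))) * norm x" for x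
          using compare[OF gd[of m] gd[of n], of x] by (simp add: blinfun.bilinear_simps G)
      qed simp
      also have "\<dots> \<le> inverse (real (Suc M)) + inverse (real (Suc M))"
        using mn by (intro add_mono le_imp_inverse_le) auto
      finally show "norm (G m - G n) < r" using M by simp
    qed
  qed
  then obtain g where g: "G \<longlonglongrightarrow> g" unfolding Cauchy_convergent_iff convergent_def by blast
  have "\<bar>\<psi> u x - blinfun_apply g x\<bar> \<le> c * norm x" if "good C c u" for C c u x
  proof (rule LIMSEQ_le)
    show "(\<lambda>n. \<bar>\<psi> u x - blinfun_apply (G n) x\<bar>) \<longlonglongrightarrow> \<bar>\<psi> u x - blinfun_apply g x\<bar>"
      by (intro tendsto_intros blinfun.tendsto g)
    show "(\<lambda>n. (c + inverse (real (Suc n))) * norm x) \<longlonglongrightarrow> c * norm x"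
      using tendsto_mult_right[OF tendsto_add[OF tendsto_const LIMSEQ_inverse_real_of_nat], of c "norm x"] by simp
    show "\<exists>N. \<forall>n\<ge>N. \<bar>\<psi> u x - blinfun_apply (G n) x\<bar> \<le> (c + inverse (real (Suc n))) * norm x"
      using compare[OF that gd] by (auto simp: G)
  qed
  then show ?thesis unfolding good_def \<psi>_def by blast
qed

lemma blinfun_nearly_attains_norm:
  fixes g :: "'x::real_normed_vector dual"
  assumes "0 < d"
  obtains x where "norm x \<le> 1" "norm g - d \<le> blinfun_apply g x"
proof (rule ccontr)
  assume "\<not> thesis"
  then have less: "blinfun_apply g x < norm g - d" if "norm x \<le> 1" for x
    using that \<open>\<And>x. norm x \<le> 1 \<Longrightarrow> norm g - d \<le> blinfun_apply g x \<Longrightarrow> thesis\<close> by force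
  have "norm g \<le> norm g - d"
  proof (rule norm_blinfun_bound)
    show "0 \<le> norm g - d" using less[of 0] by simp
    fix x
    show "norm (blinfun_apply g x) \<le> (norm g - d) * norm x"
    proof (cases "x = 0")
      case False
      then have n: "0 < norm x" by simp
      have "c * blinfun_apply g x / norm x \<le> norm g - d" if "\<bar>c\<bar> = 1" for c
        using less[of "(c / norm x) *\<^sub>R x"] n that by (simp add: blinfun.scaleR_right)
      from this[of 1] this[of "- 1"] show ?thesis
        using n by (simp add: divide_le_eq minus_divide_le_eq abs_le_iff)
    qed simp
  qed
  with assms show False by simp
qed

lemma apply_bcontfun_sum: "apply_bcontfun (sum f A) t = (\<Sum>a\<in>A. apply_bcontfun (f a) t)"
  by (induction A rule: infinite_finite_induct) auto

text \<open>Both conclusions test \<open>\<phi>\<close> on finite sums of bumps times vectors. With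
  nearly norming vectors for the \<open>g t\<close>, such a sum lies in the unit ball, so the norms
  of the \<open>g t\<close> add up to at most \<open>norm \<phi>\<close>. With the vectors
  \<open>f t\<close> it interpolates \<open>f\<close> on \<open>F\<close>, and the remainder is
  controlled by \<open>small\<close>.\<close>

lemma atomic_dual_representation:
  fixes \<phi> :: "('k::t2_space \<Rightarrow>\<^sub>C 'x::real_normed_vector) dual"
  assumes K: "compact (UNIV :: 'k set)" and \<phi>: "atomic_on \<phi> UNIV"
  obtains g :: "'k \<Rightarrow> 'x dual" where "g abs_summable_on UNIV"
    "\<And>f. ((\<lambda>t. blinfun_apply (g t) (apply_bcontfun f t)) has_sum blinfun_apply \<phi> f) UNIV"
proof -
  have "\<exists>g. \<forall>t. \<forall>F e h x. small \<phi> (- F) e \<longrightarrow> continuous_on UNIV h \<longrightarrow>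
    (\<forall>s. 0 \<le> h s \<and> h s \<le> 1) \<longrightarrow> h t = 1 \<longrightarrow> (\<forall>s\<in>F - {t}. h s = 0) \<longrightarrow>
    \<bar>blinfun_apply \<phi> (Bcontfun (\<lambda>s. h s *\<^sub>R x)) - blinfun_apply (g t) x\<bar> \<le> e * norm x"
    by (intro choice allI atom_exists[OF K \<phi>])
  then obtain g :: "'k \<Rightarrow> 'x dual" where g: "\<And>t F e h x. small \<phi> (- F) e \<Longrightarrow> continuous_on UNIV h \<Longrightarrow>
    (\<And>s. 0 \<le> h s \<and> h s \<le> 1) \<Longrightarrow> h t = 1 \<Longrightarrow> (\<And>s. s \<in> F - {t} \<Longrightarrow> h s = 0) \<Longrightarrow>
    \<bar>blinfun_apply \<phi> (Bcontfun (\<lambda>s. h s *\<^sub>R x)) - blinfun_apply (g t) x\<bar> \<le> e * norm x"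
    by metis
  define bumps where "bumps F d h \<longleftrightarrow> (\<forall>t\<in>F. continuous_on UNIV (h t)) \<and> (\<forall>t\<in>F. \<forall>s. 0 \<le> h t s) \<and>
      (\<forall>t\<in>F. h t t = 1) \<and> (\<forall>t\<in>F. \<forall>s\<in>F. s \<noteq> t \<longrightarrow> h t s = 0) \<and> (\<forall>s. (\<Sum>t\<in>F. h t s) \<le> 1) \<and>
      (\<forall>t\<in>F. \<forall>x. \<bar>blinfun_apply \<phi> (Bcontfun (\<lambda>s. h t s *\<^sub>R x)) - blinfun_apply (g t) x\<bar> \<le> d * norm x)"
    for F d and h :: "'k \<Rightarrow> 'k \<Rightarrow> real"
  have bumps_exist: "\<exists>h. bumps F d h" if F: "finite F" and d: "0 < d" for F d
  proof -
    \<comment> \<open>The accuracy \<open>d\<close> must be available for any \<open>F\<close>. The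
      bumps are therefore built for \<open>F \<union> F'\<close>, so that they vanish at the other
      points of \<open>F'\<close> as well, and only those indexed by \<open>F\<close> are
      kept.\<close>
    obtain F' where F': "finite F'" "small \<phi> (UNIV - F') d" using \<phi> d unfolding atomic_on_def by blast
    have sm: "small \<phi> (- (F \<union> F')) d" using F'(2) by (rule small_mono) auto
    have fin: "finite (F \<union> F')" using F F'(1) by simp
    obtain h :: "'k \<Rightarrow> 'k \<Rightarrow> real" where
      h: "\<And>t. t \<in> F \<union> F' \<Longrightarrow> continuous_on UNIV (h t)" "\<And>t s. t \<in> F \<union> F' \<Longrightarrow> 0 \<le> h t s"
      "\<And>t. t \<in> F \<union> F' \<Longrightarrow> h t t = 1"
      "\<And>t s. t \<in> F \<union> F' \<Longrightarrow> s \<in> F \<union> F' \<Longrightarrow> s \<noteq> t \<Longrightarrow> h t s = 0"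
      "\<And>s. (\<Sum>t\<in>F \<union> F'. h t s) \<le> 1"
      using bump_functions[OF K fin] by blast
    have h1: "h t s \<le> 1" if "t \<in> F \<union> F'" for t s
      using order_trans[OF member_le_sum[of t "F \<union> F'" "\<lambda>t. h t s"] h(5)[of s]] h(2) fin that by simp
    have "(\<Sum>t\<in>F. h t s) \<le> 1" for s
      by (rule order_trans[OF sum_mono2[OF fin] h(5)]) (use h(2) in auto)
    moreover have "\<bar>blinfun_apply \<phi> (Bcontfun (\<lambda>s. h t s *\<^sub>R x)) - blinfun_apply (g t) x\<bar> \<le> d * norm x"
      if "t \<in> F" for t x
      using that h h1 by (intro g[OF sm]) auto
    ultimately show ?thesis using h by (intro exI[of _ h]) (simp add: bumps_def)
  qed
  have sum_le: "(\<Sum>t\<in>F. norm (g t)) \<le> norm \<phi>" if F: "finite F" for F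
  proof (rule field_le_epsilon)
    fix e :: real assume e: "0 < e"
    \<comment> \<open>Each point of \<open>F\<close> costs \<open>d\<close> for the nearly norming
      vector and \<open>d\<close> for the bump.\<close>
    define d where "d = e / (2 * real (card F) + 1)"
    have d: "0 < d" using e by (simp add: d_def add_nonneg_pos)
    have "\<forall>t. \<exists>x. norm x \<le> 1 \<and> norm (g t) - d \<le> blinfun_apply (g t) x"
      using blinfun_nearly_attains_norm[OF d] by metis
    then obtain x where x: "\<And>t. norm (x t) \<le> 1" "\<And>t. norm (g t) - d \<le> blinfun_apply (g t) (x t)"
      by metis
    obtain h where "bumps F d h" using bumps_exist[OF F d] by blast
    then have h: "\<And>t. t \<in> F \<Longrightarrow> continuous_on UNIV (h t)"
      "\<And>t s. t \<in> F \<Longrightarrow> 0 \<le> h t s" "\<And>t. t \<in> F \<Longrightarrow> h t t = 1"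
      "\<And>t s. t \<in> F \<Longrightarrow> s \<in> F \<Longrightarrow> s \<noteq> t \<Longrightarrow> h t s = 0" "\<And>s. (\<Sum>t\<in>F. h t s) \<le> 1"
      "\<And>t x. t \<in> F \<Longrightarrow> \<bar>blinfun_apply \<phi> (Bcontfun (\<lambda>s. h t s *\<^sub>R x)) - blinfun_apply (g t) x\<bar> \<le> d * norm x"
      by (simp_all add: bumps_def)
    define f where "f = (\<Sum>t\<in>F. Bcontfun (\<lambda>s. h t s *\<^sub>R x t))"
    have f: "f s = (\<Sum>t\<in>F. h t s *\<^sub>R x t)" for s
      unfolding f_def apply_bcontfun_sum
      by (intro sum.cong refl) (subst apply_Bcontfun, auto intro!: K continuous_intros h)
    have "norm (f s) \<le> 1" for s
    proof -
      have "norm (f s) \<le> (\<Sum>t\<in>F. h t s * norm (x t))"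
        unfolding f using h(2) by (intro sum_norm_le) simp
      also have "\<dots> \<le> (\<Sum>t\<in>F. h t s)" using h(2) x(1) by (intro sum_mono mult_left_le) auto
      finally show ?thesis using h(5)[of s] by linarith
    qed
    then have "norm f \<le> 1" by (rule norm_bound)
    then have \<phi>f: "blinfun_apply \<phi> f \<le> norm \<phi>"
      using norm_blinfun[of \<phi> f] mult_left_le[of "norm f" "norm \<phi>"] by simp
    have "norm (g t) \<le> blinfun_apply \<phi> (Bcontfun (\<lambda>s. h t s *\<^sub>R x t)) + 2 * d" if "t \<in> F" for t
      using h(6)[OF that, of "x t"] x[of t] mult_left_le[of "norm (x t)" d] d by linarith
    then have "(\<Sum>t\<in>F. norm (g t)) \<le> (\<Sum>t\<in>F. blinfun_apply \<phi> (Bcontfun (\<lambda>s. h t s *\<^sub>R x t)) + 2 * d)"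
      by (rule sum_mono)
    also have "\<dots> = blinfun_apply \<phi> f + 2 * real (card F) * d"
      by (simp add: f_def blinfun.sum_right sum.distrib)
    also have "2 * real (card F) * d \<le> e"
      using e by (simp add: d_def divide_le_eq mult.commute)
    finally show "(\<Sum>t\<in>F. norm (g t)) \<le> norm \<phi> + e" using \<phi>f by simp
  qed
  have approx: "\<bar>blinfun_apply \<phi> f - (\<Sum>t\<in>F. blinfun_apply (g t) (apply_bcontfun f t))\<bar> \<le> e * (2 * norm f)"
    if F: "finite F" and sm: "small \<phi> (- F) e" for F e f
  proof (rule field_le_epsilon)
    fix r :: real assume r: "0 < r"
    define d where "d = r / (real (card F) * norm f + 1)"
    have n: "0 < real (card F) * norm f + 1" by (simp add: add_nonneg_pos)
    have d: "0 < d" using r n by (simp add: d_def)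
    obtain h where "bumps F d h" using bumps_exist[OF F d] by blast
    then have h: "\<And>t. t \<in> F \<Longrightarrow> continuous_on UNIV (h t)"
      "\<And>t s. t \<in> F \<Longrightarrow> 0 \<le> h t s" "\<And>t. t \<in> F \<Longrightarrow> h t t = 1"
      "\<And>t s. t \<in> F \<Longrightarrow> s \<in> F \<Longrightarrow> s \<noteq> t \<Longrightarrow> h t s = 0" "\<And>s. (\<Sum>t\<in>F. h t s) \<le> 1"
      "\<And>t x. t \<in> F \<Longrightarrow> \<bar>blinfun_apply \<phi> (Bcontfun (\<lambda>s. h t s *\<^sub>R x)) - blinfun_apply (g t) x\<bar> \<le> d * norm x"
      by (simp_all add: bumps_def)
    define u where "u = (\<Sum>t\<in>F. Bcontfun (\<lambda>s. h t s *\<^sub>R apply_bcontfun f t))"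
    have u: "u s = (\<Sum>t\<in>F. h t s *\<^sub>R f t)" for s
      unfolding u_def apply_bcontfun_sum
      by (intro sum.cong refl) (subst apply_Bcontfun, auto intro!: K continuous_intros h)
    \<comment> \<open>The interpolant \<open>u\<close> equals \<open>f\<close> on \<open>F\<close>
      and has norm at most \<open>norm f\<close>, whence the factor 2.\<close>
    have "\<bar>blinfun_apply \<phi> (f - u)\<bar> \<le> e * (2 * norm f)"
    proof (rule small_bound[OF sm])
      fix s assume "s \<notin> - F"
      then have s: "s \<in> F" by simp
      have "u s = (\<Sum>t\<in>F. if t = s then f t else 0)"
        unfolding u using h(3,4) s by (intro sum.cong) auto
      then show "(f - u) s = 0" using F s by simp
    next
      have "norm (u s) \<le> norm f" for s
      proof -
        have "norm (u s) \<le> (\<Sum>t\<in>F. h t s * norm (f t))"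
          unfolding u using h(2) by (intro sum_norm_le) simp
        also have "\<dots> \<le> (\<Sum>t\<in>F. h t s * norm f)"
          using h(2) by (intro sum_mono mult_left_mono norm_bounded)
        also have "\<dots> = (\<Sum>t\<in>F. h t s) * norm f" by (simp add: sum_distrib_right)
        also have "\<dots> \<le> 1 * norm f" using h(5) by (intro mult_right_mono) auto
        finally show ?thesis by simp
      qed
      then have "norm u \<le> norm f" by (rule norm_bound)
      then show "norm (f - u) \<le> 2 * norm f" using norm_triangle_ineq4[of f u] by linarith
    qed
    moreover have "\<bar>blinfun_apply \<phi> u - (\<Sum>t\<in>F. blinfun_apply (g t) (f t))\<bar> \<le> r"
    proof -
      have "\<bar>blinfun_apply \<phi> u - (\<Sum>t\<in>F. blinfun_apply (g t) (f t))\<bar> =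
          \<bar>\<Sum>t\<in>F. blinfun_apply \<phi> (Bcontfun (\<lambda>s. h t s *\<^sub>R f t)) - blinfun_apply (g t) (f t)\<bar>"
        by (simp add: u_def blinfun.sum_right sum_subtractf)
      also have "\<dots> \<le> (\<Sum>t\<in>F. d * norm (f t))"
        using h(6) by (intro order_trans[OF sum_abs] sum_mono)
      also have "\<dots> \<le> (\<Sum>t\<in>F. d * norm f)"
        using d by (intro sum_mono mult_left_mono norm_bounded) auto
      also have "\<dots> = (real (card F) * norm f) * d" by simp
      also have "\<dots> \<le> r" using r n by (simp add: d_def divide_le_eq field_simps)
      finally show ?thesis .
    qed
    moreover have "blinfun_apply \<phi> f = blinfun_apply \<phi> (f - u) + blinfun_apply \<phi> u"
      by (simp add: blinfun.diff_right)
    ultimately show "\<bar>blinfun_apply \<phi> f - (\<Sum>t\<in>F. blinfun_apply (g t) (apply_bcontfun f t))\<bar> \<le>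
        e * (2 * norm f) + r" by linarith
  qed
  show ?thesis
  proof (rule that[of g])
    show "g abs_summable_on UNIV"
      using sum_le by (subst abs_summable_iff_bdd_above) (auto intro!: bdd_aboveI2)
    fix f :: "'k \<Rightarrow>\<^sub>C 'x"
    show "((\<lambda>t. blinfun_apply (g t) (apply_bcontfun f t)) has_sum blinfun_apply \<phi> f) UNIV"
      unfolding has_sum_def tendsto_iff eventually_finite_subsets_at_top
    proof (intro allI impI)
      fix r :: real assume r: "0 < r"
      define e where "e = r / (2 * norm f + 1)"
      have n: "0 < 2 * norm f + 1" by (simp add: add_nonneg_pos)
      have "0 < e" using r n by (simp add: e_def)
      then obtain F where F: "finite F" "small \<phi> (UNIV - F) e" using \<phi> unfolding atomic_on_def by blast
      have less: "e * (2 * norm f) < r" using r n by (simp add: e_def field_simps)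
      have "dist (\<Sum>t\<in>Y. blinfun_apply (g t) (apply_bcontfun f t)) (blinfun_apply \<phi> f) < r"
        if "finite Y" "F \<subseteq> Y" for Y
      proof -
        have "small \<phi> (- Y) e" using F(2) by (rule small_mono) (use that(2) in auto)
        from approx[OF that(1) this, of f] less show ?thesis
          by (simp add: dist_real_def abs_minus_commute)
      qed
      with F(1) show "\<exists>F. finite F \<and> F \<subseteq> UNIV \<and> (\<forall>Y. finite Y \<and> F \<subseteq> Y \<and> Y \<subseteq> UNIV \<longrightarrow>
          dist (\<Sum>t\<in>Y. blinfun_apply (g t) (apply_bcontfun f t)) (blinfun_apply \<phi> f) < r)" by blast
    qed
  qed
qed

section \<open>Measures that are sums of atoms\<close>

lemma abs_summable_on_imp_summable_on_subset:
  fixes g :: "'k \<Rightarrow> 'e::banach"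
  shows "g abs_summable_on UNIV \<Longrightarrow> g summable_on A"
  by (rule summable_on_subset_banach[OF abs_summable_summable subset_UNIV])

text \<open>Disjointness makes \<open>snd\<close> injective on \<open>Sigma UNIV A\<close>, so the
  sum over the union is a double sum that can be evaluated block by block.\<close>

lemma infsum_sums_disjoint_family:
  fixes f :: "'k \<Rightarrow> 'e::banach"
  assumes "f abs_summable_on UNIV" "disjoint_family A"
  shows "(\<lambda>n. infsum f (A n)) sums infsum f (\<Union>n::nat. A n)"
proof -
  have inj: "inj_on snd (Sigma UNIV A)"
    using assms(2) by (auto simp: inj_on_def disjoint_family_on_def)
  have img: "snd ` Sigma UNIV A = (\<Union>n. A n)" by force
  have "(f has_sum infsum f (\<Union>n. A n)) (snd ` Sigma UNIV A)"
    unfolding img by (intro has_sum_infsum abs_summable_on_imp_summable_on_subset[OF assms(1)])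
  then have "((f \<circ> snd) has_sum infsum f (\<Union>n. A n)) (Sigma UNIV A)"
    by (simp add: has_sum_reindex[OF inj])
  moreover have "((\<lambda>t. (f \<circ> snd) (n, t)) has_sum infsum f (A n)) (A n)" for n
    using abs_summable_on_imp_summable_on_subset[OF assms(1), of "A n"] by (simp add: has_sum_infsum)
  ultimately have "((\<lambda>n. infsum f (A n)) has_sum infsum f (\<Union>n. A n)) UNIV"
    by (rule has_sum_SigmaD)
  then show ?thesis by (rule has_sum_imp_sums)
qed

lemma variation_infsum_le:
  fixes g :: "'k::topological_space \<Rightarrow> 'e::banach"
  assumes g: "g abs_summable_on UNIV"
  shows "variation (infsum g) E \<le> ennreal (\<Sum>\<^sub>\<infinity>t\<in>E. norm (g t))"
  unfolding variation_def
proof (rule SUP_least)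
  fix P assume "P \<in> {P. finite P \<and> disjoint P \<and> P \<subseteq> sets borel \<and> \<Union>P = E}"
  then have P: "finite P" "disjoint P" "\<Union>P = E" by auto
  have sm: "g abs_summable_on B" for B
    using g by (rule summable_on_subset_banach) simp
  have "(\<Sum>B\<in>P. norm (infsum g B)) \<le> (\<Sum>B\<in>P. \<Sum>\<^sub>\<infinity>t\<in>B. norm (g t))"
    by (intro sum_mono norm_infsum_bound sm)
  also have "\<dots> = (\<Sum>\<^sub>\<infinity>t\<in>(\<Union>B\<in>P. B). norm (g t))"
    using P by (intro sum_infsum sm) (auto dest: disjointD)
  finally show "(\<Sum>B\<in>P. ennreal (norm (infsum g B))) \<le> ennreal (\<Sum>\<^sub>\<infinity>t\<in>E. norm (g t))"
    using P(3) by (simp add: ennreal_leI)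
qed

text \<open>For regularity, take a finite \<open>F\<close> carrying all but \<open>r\<close> of the
  total mass, with \<open>C = F \<inter> E\<close> and \<open>U = - (F - E)\<close>. Then
  \<open>U - C\<close> is the complement of \<open>F\<close>, whatever \<open>E\<close> is.\<close>

lemma infsum_in_rcabv:
  fixes g :: "'k::t2_space \<Rightarrow> 'e::banach"
  assumes g: "g abs_summable_on UNIV"
  shows "infsum g \<in> rcabv"
proof -
  have "\<exists>C U. compact C \<and> open U \<and> C \<subseteq> E \<and> E \<subseteq> U \<and> variation (infsum g) (U - C) < \<epsilon>"
    if \<epsilon>: "0 < \<epsilon>" for E \<epsilon>
  proof -
    \<comment> \<open>\<open>\<epsilon>\<close> is an \<open>ennreal\<close>, possibly infinite; a
      positive real strictly below it makes the final inequality strict.\<close>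
    obtain c where c: "0 < c" "c < \<epsilon>" using dense[OF \<epsilon>] by blast
    then have "c \<noteq> top" by auto
    then obtain r where "c = ennreal r" "0 \<le> r" by (cases c) auto
    with c have r: "0 < r" "ennreal r < \<epsilon>" by (auto simp: ennreal_less_zero_iff)
    define s where "s B = (\<Sum>\<^sub>\<infinity>t\<in>B. norm (g t))" for B
    obtain F where F: "finite F" "dist (sum (\<lambda>t. norm (g t)) F) (s UNIV) \<le> r"
      using infsum_finite_approximation[OF g r(1)] unfolding s_def by blast
    have sm: "g abs_summable_on B" for B
      using g by (rule summable_on_subset_banach) simp
    have "s (F \<union> - F) = s F + s (- F)" unfolding s_def by (intro infsum_Un_disjoint sm) auto
    then have "s (- F) \<le> r" using F by (simp add: s_def dist_real_def Un_Diff_cancel)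
    moreover have "s (- (F - E) - F \<inter> E) \<le> s (- F)"
      unfolding s_def by (intro infsum_mono2 sm) auto
    ultimately have "ennreal (s (- (F - E) - F \<inter> E)) \<le> ennreal r" by (intro ennreal_leI) simp
    with variation_infsum_le[OF g, of "- (F - E) - F \<inter> E"]
    have "variation (infsum g) (- (F - E) - F \<inter> E) \<le> ennreal r"
      unfolding s_def by (rule order_trans)
    with r(2) have "variation (infsum g) (- (F - E) - F \<inter> E) < \<epsilon>" by (rule le_less_trans[rotated])
    moreover have "open (- (F - E))" using F(1) by (intro open_Compl finite_imp_closed) simp
    moreover have "compact (F \<inter> E)" using F(1) by (intro finite_imp_compact) simp
    ultimately show ?thesis by blast
  qed
  note regular = this
  have finite: "variation (infsum g) UNIV < \<infinity>"
    using variation_infsum_le[OF g, of UNIV] by (rule le_less_trans) simp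
  show ?thesis
    unfolding rcabv_def
    by (intro CollectI conjI allI impI ballI infsum_sums_disjoint_family g finite regular)
qed

text \<open>Induction over the centres of a finite cover of the range by balls: each new centre
  overwrites the function on the open preimage of its ball.\<close>

lemma simple_uniform_approximation:
  fixes f :: "'k::topological_space \<Rightarrow> 'x::metric_space"
  assumes "compact (UNIV :: 'k set)" and f: "continuous_on UNIV f" and "0 < e"
  obtains s where "simple_function borel s" "\<And>t. dist (s t) (f t) < e"
proof -
  have "compact (range f)" using assms(1) f by (rule compact_continuous_image[rotated])
  then obtain C where C: "finite C" "range f \<subseteq> (\<Union>x\<in>C. ball x e)"
    by (rule compactE_image[of _ "range f" "\<lambda>x. ball x e"]) (use \<open>0 < e\<close> in auto)
  have "\<exists>s. simple_function borel s \<and> (\<forall>t. f t \<in> (\<Union>x\<in>C. ball x e) \<longrightarrow> dist (s t) (f t) < e)"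
    using C(1)
  proof induction
    case empty
    \<comment> \<open>Any constant will do, since no point is covered yet.\<close>
    have "simple_function borel (\<lambda>_ :: 'k. undefined :: 'x)" by simp
    then show ?case by auto
  next
    case (insert x C)
    then obtain s where s: "simple_function borel s"
      "\<And>t. f t \<in> (\<Union>x\<in>C. ball x e) \<Longrightarrow> dist (s t) (f t) < e" by blast
    have "open (f -` ball x e)" using f by (intro open_vimage) auto
    then have "simple_function borel (\<lambda>t. if t \<in> f -` ball x e then x else s t)"
      using s(1) by (intro simple_function_If_set) auto
    then show ?case
      using s(2) by (intro exI[of _ "\<lambda>t. if t \<in> f -` ball x e then x else s t"]) auto
  qed
  then obtain s where s: "simple_function borel s"
    "\<And>t. f t \<in> (\<Union>x\<in>C. ball x e) \<Longrightarrow> dist (s t) (f t) < e" by blast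
  show ?thesis
  proof (rule that[OF s(1)])
    show "dist (s t) (f t) < e" for t using C(2) by (intro s(2)) blast
  qed
qed

lemma simple_integral_dual_infsum:
  fixes g :: "'k::topological_space \<Rightarrow> 'x::real_normed_vector dual"
  assumes g: "g abs_summable_on UNIV" and s: "simple_function borel s"
  shows "((\<lambda>t. blinfun_apply (g t) (s t)) has_sum simple_integral_dual (infsum g) s) UNIV"
proof -
  have "((\<lambda>t. blinfun_apply (g t) (s t)) has_sum blinfun_apply (infsum g (s -` {v})) v) (s -` {v})" for v
  proof -
    have "(g has_sum infsum g (s -` {v})) (s -` {v})"
      by (intro has_sum_infsum abs_summable_on_imp_summable_on_subset[OF g])
    then have "((\<lambda>t. blinfun_apply (g t) v) has_sum blinfun_apply (infsum g (s -` {v})) v) (s -` {v})"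
      by (rule has_sum_bounded_linear[where h = "\<lambda>a. blinfun_apply a v", OF blinfun.bounded_linear_left])
    moreover have "((\<lambda>t. blinfun_apply (g t) v) has_sum a) (s -` {v}) \<longleftrightarrow>
        ((\<lambda>t. blinfun_apply (g t) (s t)) has_sum a) (s -` {v})" for a
      by (rule has_sum_cong) auto
    ultimately show ?thesis by simp
  qed
  then have "((\<lambda>t. blinfun_apply (g t) (s t)) has_sum
      (\<Sum>v\<in>range s. blinfun_apply (infsum g (s -` {v})) v)) (\<Union>v\<in>range s. s -` {v})"
    using simple_functionD(1)[OF s] by (intro sum_has_sum) auto
  moreover have "(\<Union>v\<in>range s. s -` {v}) = UNIV" by auto
  ultimately show ?thesis by (simp add: simple_integral_dual_def)
qed

text \<open>The integral of a simple function differs from \<open>\<phi> f\<close> by at most its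
  uniform distance to \<open>f\<close> times the sum of the norms of the \<open>g t\<close>.\<close>

lemma infsum_corresponds_to:
  fixes g :: "'k::t2_space \<Rightarrow> 'x::real_normed_vector dual"
  assumes K: "compact (UNIV :: 'k set)" and g: "g abs_summable_on UNIV"
    and \<phi>: "\<And>f. ((\<lambda>t. blinfun_apply (g t) (apply_bcontfun f t)) has_sum blinfun_apply \<phi> f) UNIV"
  shows "corresponds_to (infsum g) \<phi>"
  unfolding corresponds_to_def
proof (intro conjI allI infsum_in_rcabv g)
  fix f :: "'k \<Rightarrow>\<^sub>C 'x"
  have "\<exists>s :: 'k \<Rightarrow> 'x. simple_function borel s \<and> (\<forall>t. dist (s t) (f t) < inverse (real (Suc n)))" for n
    by (rule simple_uniform_approximation[OF K, of "apply_bcontfun f" "inverse (real (Suc n))"]) auto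
  then obtain s where s: "\<And>n. simple_function borel (s n)"
    "\<And>n t. dist (s n t) (f t) < inverse (real (Suc n))" by metis
  have lim0: "(\<lambda>n. inverse (real (Suc n))) \<longlonglongrightarrow> 0" by (rule LIMSEQ_inverse_real_of_nat)
  have "uniform_limit UNIV s f sequentially"
  proof (rule uniform_limitI)
    fix e :: real assume "0 < e"
    with lim0 have "\<forall>\<^sub>F n in sequentially. inverse (real (Suc n)) < e" by (rule order_tendstoD)
    then show "\<forall>\<^sub>F n in sequentially. \<forall>t\<in>UNIV. dist (s n t) (f t) < e"
      by eventually_elim (use s(2) in \<open>auto intro: less_trans\<close>)
  qed
  moreover have "(\<lambda>n. simple_integral_dual (infsum g) (s n)) \<longlonglongrightarrow> blinfun_apply \<phi> f"
  proof (rule LIM_zero_cancel, rule Lim_null_comparison)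
    define N where "N = (\<Sum>\<^sub>\<infinity>t. norm (g t))"
    show "(\<lambda>n. inverse (real (Suc n)) * N) \<longlonglongrightarrow> 0"
      using tendsto_mult_right[OF lim0, of N] by simp
    have "norm (simple_integral_dual (infsum g) (s n) - blinfun_apply \<phi> f) \<le> inverse (real (Suc n)) * N" for n
    proof (rule norm_infsum_le)
      show "((\<lambda>t. blinfun_apply (g t) (s n t) - blinfun_apply (g t) (f t)) has_sum
          (simple_integral_dual (infsum g) (s n) - blinfun_apply \<phi> f)) UNIV"
        using has_sum_add[OF simple_integral_dual_infsum[OF g s(1)] has_sum_uminusI[OF \<phi>]]
        by simp
      show "((\<lambda>t. inverse (real (Suc n)) * norm (g t)) has_sum inverse (real (Suc n)) * N) UNIV"
        unfolding N_def by (intro has_sum_cmult_right has_sum_infsum g)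
      fix t
      have "norm (blinfun_apply (g t) (s n t - f t)) \<le> norm (g t) * norm (s n t - f t)"
        by (rule norm_blinfun)
      also have "\<dots> \<le> norm (g t) * inverse (real (Suc n))"
        using s(2)[of n t] by (intro mult_left_mono) (auto simp: dist_norm)
      finally show "norm (blinfun_apply (g t) (s n t) - blinfun_apply (g t) (f t)) \<le>
          inverse (real (Suc n)) * norm (g t)"
        by (simp add: blinfun.diff_right mult.commute)
    qed
    then show "\<forall>\<^sub>F n in sequentially. norm (simple_integral_dual (infsum g) (s n) - blinfun_apply \<phi> f)
        \<le> inverse (real (Suc n)) * N" by simp
  qed
  ultimately show "has_integral_dual (infsum g) (apply_bcontfun f) (blinfun_apply \<phi> f)"
    unfolding has_integral_dual_def using s(1) by blast
qed

section \<open>Strongly bounded operators\<close>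

text \<open>The value of \<open>y\<close> at \<open>T\<close> applied to \<open>f\<close> is the
  series of the functional \<open>y o\<^sub>L T\<close>. Its coefficients are the atoms of
  \<open>m\<close>, because the second adjoint evaluates the indicator functional of
  \<open>{t}\<close> at \<open>y o\<^sub>L T\<close>, where the measure \<open>infsum g\<close>
  determines it.\<close>

lemma scalarization_atomic:
  fixes T :: "('k::t2_space \<Rightarrow>\<^sub>C 'x::real_normed_vector) \<Rightarrow>\<^sub>L 'y::real_normed_vector"
  assumes K: "compact (UNIV :: 'k set)" and "dispersed TYPE('k)" and m: "representing_measure m T"
  shows "((\<lambda>t. blinfun_apply (scalarization y m {t}) (apply_bcontfun f t)) has_sum
      blinfun_apply y (blinfun_apply T f)) UNIV"
proof -
  have "atomic_on (y o\<^sub>L T) UNIV" using assms(1,2) by (rule dispersed_imp_atomic)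
  then obtain g :: "'k \<Rightarrow> 'x dual" where g: "g abs_summable_on UNIV"
    and sum: "\<And>f. ((\<lambda>t. blinfun_apply (g t) (apply_bcontfun f t)) has_sum blinfun_apply (y o\<^sub>L T) f) UNIV"
    using atomic_dual_representation[OF K] by blast
  have corr: "corresponds_to (infsum g) (y o\<^sub>L T)" using K g sum by (rule infsum_corresponds_to)
  have "scalarization y m {t} = g t" for t
  proof (rule blinfun_eqI)
    fix x
    have "{t} \<in> sets borel" by simp
    then obtain \<xi> where \<xi>: "is_indicator_functional {t} x \<xi>"
      "blinfun_apply (m {t}) x = blinfun_apply (adjoint_blinfun (adjoint_blinfun T)) \<xi>"
      using m unfolding representing_measure_def by blast
    have "blinfun_apply (scalarization y m {t}) x = blinfun_apply \<xi> (y o\<^sub>L T)"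
      by (simp add: scalarization_apply \<xi>(2))
    also have "\<dots> = blinfun_apply (infsum g {t}) x"
      using \<xi>(1) corr unfolding is_indicator_functional_def by blast
    finally show "blinfun_apply (scalarization y m {t}) x = blinfun_apply (g t) x" by simp
  qed
  then show ?thesis using sum[of f] by simp
qed

lemma sum_atoms_le_variation:
  fixes E :: "'k::t2_space set"
  assumes "finite F" "F \<subseteq> E" "E \<in> sets borel"
  shows "ennreal (\<Sum>t\<in>F. norm (\<mu> {t})) \<le> variation \<mu> E"
proof -
  \<comment> \<open>The remainder \<open>E - F\<close> only completes the singletons to a Borel
    partition of \<open>E\<close>.\<close>
  define P where "P = insert (E - F) ((\<lambda>t. {t}) ` F)"
  have "F \<in> sets borel" using assms(1) by (intro borel_closed finite_imp_closed)
  then have "P \<in> {P. finite P \<and> disjoint P \<and> P \<subseteq> sets borel \<and> \<Union>P = E}"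
    using assms by (auto simp: P_def disjoint_def)
  then have "(\<Sum>B\<in>P. ennreal (norm (\<mu> B))) \<le> variation \<mu> E"
    unfolding variation_def by (rule SUP_upper)
  moreover have "(\<Sum>B\<in>(\<lambda>t. {t}) ` F. ennreal (norm (\<mu> B))) \<le> (\<Sum>B\<in>P. ennreal (norm (\<mu> B)))"
    using assms(1) by (intro sum_mono2) (auto simp: P_def)
  moreover have "(\<Sum>B\<in>(\<lambda>t. {t}) ` F. ennreal (norm (\<mu> B))) = ennreal (\<Sum>t\<in>F. norm (\<mu> {t}))"
    by (subst sum.reindex) (auto simp: sum_ennreal)
  ultimately show ?thesis by simp
qed

text \<open>Otherwise there are disjoint finite sets \<open>F i\<close> of semivariation at least \<open>e\<close>, and the tails
  \<open>\<Union>i\<ge>n. F i\<close> decrease to the empty set.\<close>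

lemma strongly_bounded_imp_uniform_tails:
  fixes m :: "'k::t2_space set \<Rightarrow> 'x::real_normed_vector \<Rightarrow>\<^sub>L 'y::real_normed_vector dual dual"
  assumes m: "strongly_bounded m" and e: "0 < e"
  obtains F0 where "finite F0"
    "\<And>F y. finite F \<Longrightarrow> F \<inter> F0 = {} \<Longrightarrow> norm y \<le> 1 \<Longrightarrow> (\<Sum>t\<in>F. norm (scalarization y m {t})) \<le> e"
proof (rule ccontr)
  assume "\<not> thesis"
  then have "\<forall>F0. \<exists>F y. finite F0 \<longrightarrow> finite F \<and> F \<inter> F0 = {} \<and> norm y \<le> 1 \<and>
      e < (\<Sum>t\<in>F. norm (scalarization y m {t}))"
    by (metis that not_le)
  then obtain H Y where H: "\<And>F0. finite F0 \<Longrightarrow> finite (H F0)" "\<And>F0. finite F0 \<Longrightarrow> H F0 \<inter> F0 = {}"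
    and Y: "\<And>F0. finite F0 \<Longrightarrow> norm (Y F0) \<le> 1"
      "\<And>F0. finite F0 \<Longrightarrow> e < (\<Sum>t\<in>H F0. norm (scalarization (Y F0) m {t}))"
    by metis
  \<comment> \<open>\<open>U n\<close> collects the blocks chosen so far, so the next block
    \<open>H (U n)\<close> is disjoint from all of them and a point lies in at most one
    block.\<close>
  define U where "U = rec_nat {} (\<lambda>n V. V \<union> H V)"
  have U_simps: "U 0 = {}" "\<And>n. U (Suc n) = U n \<union> H (U n)" by (simp_all add: U_def)
  have U: "finite (U n)" for n by (induction n) (simp_all add: U_simps H)
  have U_mono: "U i \<subseteq> U j" if "i \<le> j" for i j
    by (rule lift_Suc_mono_le[OF _ that]) (simp add: U_simps)
  define A where "A n = (\<Union>i\<in>{n..}. H (U i))" for n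
  have A: "A n \<in> sets borel" for n
  proof (rule sets.countable)
    show "countable (A n)" unfolding A_def using H(1)[OF U] by (auto intro: countable_finite)
  qed simp
  have "t \<notin> (\<Inter>n. A n)" for t
  proof
    assume t: "t \<in> (\<Inter>n. A n)"
    then obtain i where "t \<in> H (U i)" by (auto simp: A_def)
    then have i: "t \<in> U (Suc i)" by (simp add: U_simps)
    from t obtain j where "Suc i \<le> j" "t \<in> H (U j)" by (auto simp: A_def)
    with i U_mono[of "Suc i" j] H(2)[OF U, of j] show False by blast
  qed
  then have "(\<Inter>n. A n) = {}" by blast
  moreover have "decseq A" unfolding A_def by (intro decseq_SucI UN_mono) auto
  ultimately have "(\<lambda>n. semivariation m (A n)) \<longlonglongrightarrow> 0"
    using m A unfolding strongly_bounded_def by blast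
  moreover have "0 < ennreal e" using e by simp
  ultimately have "\<forall>\<^sub>F n in sequentially. semivariation m (A n) < ennreal e"
    by (rule order_tendstoD(2))
  then obtain n where n: "semivariation m (A n) < ennreal e"
    using eventually_happens'[OF sequentially_bot] by blast
  \<comment> \<open>The functional \<open>Y (U n)\<close> changes with \<open>n\<close>; the
    supremum over \<open>y\<close> in the semivariation absorbs this.\<close>
  have "ennreal e \<le> ennreal (\<Sum>t\<in>H (U n). norm (scalarization (Y (U n)) m {t}))"
    using Y(2)[OF U[of n]] by (intro ennreal_leI) simp
  also have "\<dots> \<le> variation (scalarization (Y (U n)) m) (A n)"
    using A[of n] H(1)[OF U[of n]] by (intro sum_atoms_le_variation) (auto simp: A_def)
  also have "\<dots> \<le> semivariation m (A n)"
    unfolding semivariation_def using Y(1)[OF U[of n]] by (intro SUP_upper) simp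
  finally show False using n by simp
qed

lemma norm_le_on_unit_ball:
  fixes g :: "'x::real_normed_vector dual"
  assumes "\<And>x. norm x \<le> 1 \<Longrightarrow> blinfun_apply g x \<le> c"
  shows "norm g \<le> c"
proof (rule field_le_epsilon)
  fix e :: real assume "0 < e"
  then obtain x where "norm x \<le> 1" "norm g - e \<le> blinfun_apply g x"
    by (rule blinfun_nearly_attains_norm)
  with assms[of x] show "norm g \<le> c + e" by simp
qed

text \<open>One set \<open>F0\<close> serves all \<open>f\<close> and all \<open>y\<close> in the
  unit ball, so the pointwise series become an estimate in the norm of the bidual. Larger finite
  sets are allowed so that a prescribed point can be added.\<close>

lemma finite_atom_approximation:
  fixes T :: "('k::t2_space \<Rightarrow>\<^sub>C 'x::real_normed_vector) \<Rightarrow>\<^sub>L 'y::real_normed_vector"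
  assumes K: "compact (UNIV :: 'k set)" "dispersed TYPE('k)"
    and m: "representing_measure m T" "strongly_bounded m" and e: "0 < e"
  obtains F0 where "finite F0"
    "\<And>F f. finite F \<Longrightarrow> F0 \<subseteq> F \<Longrightarrow>
      norm (canonical_embedding (blinfun_apply T f) - (\<Sum>t\<in>F. blinfun_apply (m {t}) (apply_bcontfun f t)))
        \<le> e * norm f"
proof -
  obtain F0 where F0: "finite F0" "\<And>F y. finite F \<Longrightarrow> F \<inter> F0 = {} \<Longrightarrow> norm y \<le> 1 \<Longrightarrow>
      (\<Sum>t\<in>F. norm (scalarization y m {t})) \<le> e"
    using strongly_bounded_imp_uniform_tails[OF m(2) e] by blast
  show ?thesis
  proof (rule that[OF F0(1)], rule norm_le_on_unit_ball)
    fix F :: "'k set" and f :: "'k \<Rightarrow>\<^sub>C 'x" and y :: "'y dual"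
    assume F: "finite F" "F0 \<subseteq> F" and y: "norm y \<le> 1"
    define a where "a t = blinfun_apply (scalarization y m {t}) (apply_bcontfun f t)" for t
    have sum: "(sum a \<longlongrightarrow> blinfun_apply y (blinfun_apply T f)) (finite_subsets_at_top UNIV)"
      using scalarization_atomic[OF K m(1), of y f] by (simp add: a_def[abs_def] has_sum_def)
    \<comment> \<open>A one-sided bound suffices, because the unit ball contains \<open>- y\<close>
      along with \<open>y\<close>.\<close>
    have "sum a G - sum a F \<le> e * norm f" if G: "finite G" "F \<subseteq> G" for G
    proof -
      have "sum a G - sum a F = sum a (G - F)" using G by (simp add: sum_diff)
      also have "\<dots> \<le> (\<Sum>t\<in>G - F. norm (scalarization y m {t}) * norm f)"
      proof (rule sum_mono)
        fix t
        have "a t \<le> norm (scalarization y m {t}) * norm (apply_bcontfun f t)"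
          using norm_blinfun[of "scalarization y m {t}" "apply_bcontfun f t"] by (simp add: a_def)
        also have "\<dots> \<le> norm (scalarization y m {t}) * norm f"
          by (intro mult_left_mono norm_bounded) simp
        finally show "a t \<le> norm (scalarization y m {t}) * norm f" .
      qed
      also have "\<dots> = (\<Sum>t\<in>G - F. norm (scalarization y m {t})) * norm f"
        by (simp add: sum_distrib_right)
      also have "\<dots> \<le> e * norm f"
        using F(2) G(1) y by (intro mult_right_mono F0(2)) auto
      finally show ?thesis .
    qed
    then have "\<forall>\<^sub>F G in finite_subsets_at_top UNIV. sum a G - sum a F \<le> e * norm f"
      using F(1) unfolding eventually_finite_subsets_at_top by blast
    then have "blinfun_apply y (blinfun_apply T f) - sum a F \<le> e * norm f"
      by (intro tendsto_upperbound[OF tendsto_diff[OF sum tendsto_const]]) auto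
    then show "blinfun_apply (canonical_embedding (blinfun_apply T f) -
        (\<Sum>t\<in>F. blinfun_apply (m {t}) (apply_bcontfun f t))) y \<le> e * norm f"
      by (simp add: a_def scalarization_apply blinfun.diff_left blinfun.sum_left)
  qed
qed

text \<open>For a bump \<open>h\<close> at \<open>t\<close> that vanishes on
  \<open>F0 - {t}\<close>, the finite sum over \<open>insert t F0\<close> for the function
  \<open>h x\<close> reduces to \<open>m {t} x\<close>, which is therefore close to an embedded
  value of \<open>T\<close>.\<close>

lemma atom_in_range_canonical_embedding:
  fixes T :: "('k::t2_space \<Rightarrow>\<^sub>C 'x::real_normed_vector) \<Rightarrow>\<^sub>L 'y::banach"
  assumes K: "compact (UNIV :: 'k set)" "dispersed TYPE('k)"
    and m: "representing_measure m T" "strongly_bounded m"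
  shows "blinfun_apply (m {t}) x \<in> range canonical_embedding"
proof -
  have "\<exists>z\<in>range canonical_embedding. dist z (blinfun_apply (m {t}) x) < e" if "0 < e" for e
  proof -
    define c where "c = e / (norm x + 1)"
    have n: "0 < norm x + 1" by (simp add: add_nonneg_pos)
    have "0 < c" using \<open>0 < e\<close> n by (simp add: c_def)
    then obtain F0 where F0: "finite F0" "\<And>F f. finite F \<Longrightarrow> F0 \<subseteq> F \<Longrightarrow>
      norm (canonical_embedding (blinfun_apply T f) - (\<Sum>t\<in>F. blinfun_apply (m {t}) (apply_bcontfun f t)))
        \<le> c * norm f"
      using finite_atom_approximation[OF K m] by blast
    have "closed (F0 - {t})" using F0(1) by (intro finite_imp_closed) simp
    then obtain h :: "'k \<Rightarrow> real" where h: "continuous_on UNIV h" "\<And>s. 0 \<le> h s" "\<And>s. h s \<le> 1"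
      "\<And>s. s \<in> F0 - {t} \<Longrightarrow> h s = 0" "\<And>s. s \<in> {t} \<Longrightarrow> h s = 1"
      by (rule Urysohn_compact_t2[OF K(1) _ closed_singleton[of t]]) auto
    define f where "f = Bcontfun (\<lambda>s. h s *\<^sub>R x)"
    have f: "apply_bcontfun f = (\<lambda>s. h s *\<^sub>R x)"
      unfolding f_def by (intro apply_Bcontfun K continuous_intros h)
    have "norm f \<le> norm x" using h(2,3) by (intro norm_bound) (simp add: f mult_left_le_one_le)
    have "(\<Sum>s\<in>insert t F0. blinfun_apply (m {s}) (apply_bcontfun f s)) =
        (\<Sum>s\<in>insert t F0. if s = t then blinfun_apply (m {s}) x else 0)"
      using h(4,5) by (intro sum.cong) (auto simp: f)
    also have "\<dots> = blinfun_apply (m {t}) x" using F0(1) by simp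
    finally have "dist (canonical_embedding (blinfun_apply T f)) (blinfun_apply (m {t}) x) \<le> c * norm f"
      using F0(2)[of "insert t F0" f] F0(1) by (auto simp: dist_norm)
    also have "\<dots> \<le> c * norm x" using \<open>norm f \<le> norm x\<close> \<open>0 < c\<close> by (intro mult_left_mono) auto
    also have "\<dots> < e" using \<open>0 < e\<close> n by (simp add: c_def divide_less_eq algebra_simps)
    finally show ?thesis by blast
  qed
  then show ?thesis using closed_approachable[OF closed_range_canonical_embedding] by blast
qed

text \<open>With a common bound \<open>M\<close> on the norms, accuracy \<open>r / (2 * M)\<close>
  yields one finite set for all \<open>n\<close>; on it the convergence at single points is
  uniform.\<close>

lemma atom_convergence_imp_convergence:
  fixes T :: "('k::t2_space \<Rightarrow>\<^sub>C 'x::real_normed_vector) \<Rightarrow>\<^sub>L 'y::banach"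
  assumes K: "compact (UNIV :: 'k set)" "dispersed TYPE('k)"
    and m: "representing_measure m T" "strongly_bounded m"
    and f: "bounded (range f)"
    and lim: "\<And>t. (\<lambda>n. blinfun_apply (into_predual (m {t})) (apply_bcontfun (f n) t)) \<longlonglongrightarrow> 0"
  shows "(\<lambda>n. blinfun_apply T (f n)) \<longlonglongrightarrow> 0"
proof (rule LIMSEQ_I)
  fix r :: real assume r: "0 < r"
  obtain M where M: "0 < M" "\<And>n. norm (f n) \<le> M" using f by (auto simp: bounded_pos)
  have "0 < r / (2 * M)" using r M(1) by simp
  then obtain F where F: "finite F" "\<And>G f. finite G \<Longrightarrow> F \<subseteq> G \<Longrightarrow>
      norm (canonical_embedding (blinfun_apply T f) - (\<Sum>t\<in>G. blinfun_apply (m {t}) (apply_bcontfun f t)))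
        \<le> r / (2 * M) * norm f"
    using finite_atom_approximation[OF K m] by blast
  define b where "b n = (\<Sum>t\<in>F. norm (blinfun_apply (m {t}) (apply_bcontfun (f n) t)))" for n
  have norm_atom: "norm (blinfun_apply (m {t}) x) = norm (blinfun_apply (into_predual (m {t})) x)" for t x
    using into_predual_apply[OF atom_in_range_canonical_embedding[OF K m]]
    by (metis norm_canonical_embedding)
  have "b \<longlonglongrightarrow> 0"
    unfolding b_def norm_atom using lim by (intro tendsto_null_sum tendsto_norm_zero)
  then obtain N where N: "\<And>n. N \<le> n \<Longrightarrow> norm (b n) < r / 2"
    using LIMSEQ_D[of b 0 "r / 2"] r by auto
  show "\<exists>N. \<forall>n\<ge>N. norm (blinfun_apply T (f n) - 0) < r"
  proof (intro exI allI impI)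
    fix n assume "N \<le> n"
    let ?z = "canonical_embedding (blinfun_apply T (f n))"
    let ?s = "\<Sum>t\<in>F. blinfun_apply (m {t}) (apply_bcontfun (f n) t)"
    have "norm (?z - ?s) \<le> r / (2 * M) * norm (f n)" using F by simp
    also have "\<dots> \<le> r / (2 * M) * M" using M r by (intro mult_left_mono) auto
    also have "\<dots> = r / 2" using M(1) by simp
    finally have "norm (?z - ?s) \<le> r / 2" .
    moreover have "norm ?s \<le> b n" unfolding b_def by (rule norm_sum)
    ultimately have "norm ?z < r"
      using N[OF \<open>N \<le> n\<close>] norm_triangle_sub[of ?z ?s] by simp
    then show "norm (blinfun_apply T (f n) - 0) < r" by simp
  qed
qed

section \<open>Images of sequences and limited sets under operators\<close>

definition evaluation :: "'k::topological_space \<Rightarrow> ('k \<Rightarrow>\<^sub>C 'x::real_normed_vector) \<Rightarrow>\<^sub>L 'x" where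
  "evaluation t = Blinfun (\<lambda>f. apply_bcontfun f t)"

lemma evaluation_apply [simp]:
  fixes f :: "'k::topological_space \<Rightarrow>\<^sub>C 'x::real_normed_vector"
  shows "blinfun_apply (evaluation t) f = apply_bcontfun f t"
proof -
  have "bounded_linear (\<lambda>f :: 'k \<Rightarrow>\<^sub>C 'x. apply_bcontfun f t)"
    by (rule bounded_linear_intro[where K = 1]) (auto intro: norm_bounded)
  then show ?thesis by (simp add: evaluation_def bounded_linear_Blinfun_apply)
qed

lemma weakly_null_blinfun_image:
  assumes "weakly_null x"
  shows "weakly_null (\<lambda>n. blinfun_apply L (x n))"
  unfolding weakly_null_def
proof
  fix \<phi> :: "'b dual"
  from assms show "(\<lambda>n. blinfun_apply \<phi> (blinfun_apply L (x n))) \<longlonglongrightarrow> 0"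
    unfolding weakly_null_def by (elim allE[of _ "\<phi> o\<^sub>L L"]) simp
qed

lemma weakly_p_summable_blinfun_image:
  assumes "weakly_p_summable p x"
  shows "weakly_p_summable p (\<lambda>n. blinfun_apply L (x n))"
  unfolding weakly_p_summable_def
proof
  fix \<phi> :: "'b dual"
  from assms show "summable (\<lambda>n. \<bar>blinfun_apply \<phi> (blinfun_apply L (x n))\<bar> powr p)"
    unfolding weakly_p_summable_def by (elim allE[of _ "\<phi> o\<^sub>L L"]) simp
qed

text \<open>Composing a weak-star null sequence with \<open>L\<close> gives a weak-star null
  sequence on the domain, with the same suprema.\<close>

lemma limited_blinfun_image:
  assumes "limited A"
  shows "limited (blinfun_apply L ` A)"
  unfolding limited_def
proof (intro conjI allI impI)
  show "bounded (blinfun_apply L ` A)"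
    using assms by (intro bounded_linear_image blinfun.bounded_linear_right) (simp add: limited_def)
  fix \<phi> :: "nat \<Rightarrow> 'b dual"
  assume "\<forall>x. (\<lambda>n. blinfun_apply (\<phi> n) x) \<longlonglongrightarrow> 0"
  then have "\<forall>x. (\<lambda>n. blinfun_apply (\<phi> n o\<^sub>L L) x) \<longlonglongrightarrow> 0" by simp
  with assms[unfolded limited_def, THEN conjunct2, THEN spec[of _ "\<lambda>n. \<phi> n o\<^sub>L L"]]
  have "(\<lambda>n. SUP x\<in>A. ennreal \<bar>blinfun_apply (\<phi> n o\<^sub>L L) x\<bar>) \<longlonglongrightarrow> 0" by (rule mp)
  then show "(\<lambda>n. SUP x\<in>blinfun_apply L ` A. ennreal \<bar>blinfun_apply (\<phi> n) x\<bar>) \<longlonglongrightarrow> 0"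
    by (simp add: image_image)
qed

theorem corollary18:
  fixes T :: "('k::t2_space \<Rightarrow>\<^sub>C 'x::banach) \<Rightarrow>\<^sub>L 'y::banach"
    and m :: "'k set \<Rightarrow> 'x \<Rightarrow>\<^sub>L 'y dual dual"
    and p :: real
  assumes "1 \<le> p"
    and "compact (UNIV :: 'k set)"
    and "dispersed TYPE('k)"
    and "representing_measure m T"
    and "strongly_bounded m"
  shows "((\<forall>A\<in>sets borel. limited_completely_continuous (into_predual (m A))) \<longrightarrow>
            limited_completely_continuous T) \<and>
         ((\<forall>A\<in>sets borel. limited_p_convergent p (into_predual (m A))) \<longrightarrow>
            limited_p_convergent p T)"
proof (intro conjI impI)
  have limited_at: "limited (range (\<lambda>n. apply_bcontfun (f n) t))" if "limited (range f)"
    for f :: "nat \<Rightarrow> 'k \<Rightarrow>\<^sub>C 'x" and t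
    using limited_blinfun_image[OF that, of "evaluation t"] by (simp add: image_image)
  note convergence = atom_convergence_imp_convergence[OF assms(2-5)]
  {
    assume m: "\<forall>A\<in>sets borel. limited_completely_continuous (into_predual (m A))"
    show "limited_completely_continuous T"
      unfolding limited_completely_continuous_def
    proof (intro allI impI, elim conjE)
      fix f :: "nat \<Rightarrow> 'k \<Rightarrow>\<^sub>C 'x" assume f: "weakly_null f" "limited (range f)"
      show "(\<lambda>n. blinfun_apply T (f n)) \<longlonglongrightarrow> 0"
      proof (rule convergence)
        show "bounded (range f)" using f(2) by (simp add: limited_def)
        fix t
        have "weakly_null (\<lambda>n. apply_bcontfun (f n) t)"
          using weakly_null_blinfun_image[OF f(1), of "evaluation t"] by simp
        \<comment> \<open>Points are closed, so \<open>{t}\<close> is Borel and the hypothesis on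
          \<open>m\<close> applies.\<close>
        moreover have "limited_completely_continuous (into_predual (m {t}))" using m by simp
        ultimately show "(\<lambda>n. blinfun_apply (into_predual (m {t})) (apply_bcontfun (f n) t)) \<longlonglongrightarrow> 0"
          using limited_at[OF f(2)] unfolding limited_completely_continuous_def by blast
      qed
    qed
  next
    assume m: "\<forall>A\<in>sets borel. limited_p_convergent p (into_predual (m A))"
    show "limited_p_convergent p T"
      unfolding limited_p_convergent_def
    proof (intro allI impI, elim conjE)
      fix f :: "nat \<Rightarrow> 'k \<Rightarrow>\<^sub>C 'x" assume f: "weakly_p_summable p f" "limited (range f)"
      show "(\<lambda>n. blinfun_apply T (f n)) \<longlonglongrightarrow> 0"
      proof (rule convergence)
        show "bounded (range f)" using f(2) by (simp add: limited_def)
        fix t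
        have "weakly_p_summable p (\<lambda>n. apply_bcontfun (f n) t)"
          using weakly_p_summable_blinfun_image[OF f(1), of "evaluation t"] by simp
        moreover have "limited_p_convergent p (into_predual (m {t}))" using m by simp
        ultimately show "(\<lambda>n. blinfun_apply (into_predual (m {t})) (apply_bcontfun (f n) t)) \<longlonglongrightarrow> 0"
          using limited_at[OF f(2)] unfolding limited_p_convergent_def by blast
      qed
    qed
  }
qed

end
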